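(* Let $(w_k)_{k=0}^\infty$ be a fixed weight sequence, and let $\Phi$, $\rho$, $\tau$, $(\pi_k)_{k\ge0}$ and $\Phi_\tau$ be as defined in the context. Let $\mathcal T_n$ be the simply generated random tree with $n$ nodes defined by $(w_k)$. For a finite rooted tree $T$ let $n_{\mathsf p}(T)$ be the number of protected nodes of $T$ and $p_{\mathsf p}(T):=n_{\mathsf p}(T)/|T|$. Then the following holds as $n\to\infty$. (i) (Annealed version.) The probability $p_n=\mathbb E\, p_{\mathsf p}(\mathcal T_n)$ that a (uniformly) random node in the random tree $\mathcal T_n$ is protected tends to a limit $p_*$ as $n\to\infty$, with $$p_* := \Phi_\tau(1-\pi_0)-\pi_0=\frac{\Phi\bigl(\tau-\tau w_0/\Phi(\tau)\bigr)-w_0}{\Phi(\tau)}.$$ (ii) (Quenched version.) The proportion of nodes in $\mathcal T_n$ that are protected, i.e. $p_{\mathsf p}(\mathcal T_n)=n_{\mathsf p}(\mathcal T_n)/n$, converges in probability to $p_*$ as $n\to\infty$.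
   Context: All trees are finite, rooted and ordered (plane). $|T|$ is the number of nodes of $T$, and $d^+(v)$ is the outdegree (number of children) of a node $v$. A leaf is a node with no children. A node is protected if it is not a leaf and none of its children is a leaf. Simply generated random trees: given a weight sequence $(w_k)_{k\ge0}$ (non-negative real numbers), the weight of a tree $T$ is $w(T):=\prod_{v\in T}w_{d^+(v)}$. For $n\ge1$, $\mathcal T_n$ is the random tree obtained by selecting an ordered rooted tree with $n$ nodes with probability proportional to its weight. Only those $n$ for which at least one tree with $n$ nodes has positive weight are considered. Notation: $\Phi(t):=\sum_{k=0}^\infty w_kt^k$ is the generating function of the weight sequence, and $\rho\in[0,\infty]$ is its radius of convergence. The parameter $\tau\ge0$ is defined as follows: (i) $\tau$ is the unique number in $[0,\rho]$ such that $\tau\Phi'(\tau)=\Phi(\tau)<\infty$, if there exists any such $\tau$; (ii) if there is no such number, then $\tau:=\rho$. It is part of the setting that $\Phi(\tau)<\infty$ also in case (ii). Define $\pi_k:=w_k\tau^k/\Phi(\tau)$ for $k\ge0$; then $\sum_k\pi_k=1$, so $(\pi_k)_{k\ge0}$ is a probability distribution on $\{0,1,2,\dots\}$, with generating function $\Phi_\tau(t):=\sum_k\pi_kt^k=\Phi(\tau t)/\Phi(\tau)$. *)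

theory Defs
  imports "HOL-Probability.Probability"
begin

section \<open>Plane trees\<close>

datatype ptree = Node (children: "ptree list")

text \<open>
  A node \<open>v\<close> of a tree is represented by the fringe subtree rooted at \<open>v\<close>.  The list
  \<open>nodes T\<close> (in preorder) has exactly one entry for every node of \<open>T\<close>: equal fringe subtrees at
  different nodes give different entries.
\<close>

primrec nodes :: "ptree \<Rightarrow> ptree list" where
  "nodes (Node ts) = Node ts # concat (map nodes ts)"

definition tree_size :: "ptree \<Rightarrow> nat" where
  "tree_size T = length (nodes T)"

definition outdegree :: "ptree \<Rightarrow> nat" where
  "outdegree v = length (children v)"

definition is_leaf :: "ptree \<Rightarrow> bool" where
  "is_leaf v \<longleftrightarrow> outdegree v = 0"

definition is_protected :: "ptree \<Rightarrow> bool" where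
  "is_protected v \<longleftrightarrow> \<not> is_leaf v \<and> (\<forall>u \<in> set (children v). \<not> is_leaf u)"

definition num_protected :: "ptree \<Rightarrow> nat" where
  "num_protected T = length (filter is_protected (nodes T))"

definition prop_protected :: "ptree \<Rightarrow> real" where
  "prop_protected T = real (num_protected T) / real (tree_size T)"

section \<open>Simply generated random trees\<close>

definition weight :: "(nat \<Rightarrow> real) \<Rightarrow> ptree \<Rightarrow> real" where
  "weight w T = (\<Prod>v\<leftarrow>nodes T. w (outdegree v))"

definition trees_of_size :: "nat \<Rightarrow> ptree set" where
  "trees_of_size n = {T. tree_size T = n}"

text \<open>The values of \<open>n\<close> for which the random tree with \<open>n\<close> nodes exists.\<close>

definition admissible :: "(nat \<Rightarrow> real) \<Rightarrow> nat set" where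
  "admissible w = {n. \<exists>T \<in> trees_of_size n. weight w T > 0}"

text \<open>
  Meaningful only for non-negative \<open>w\<close> and \<open>n \<in> admissible w\<close>; see
  \<open>pmf_simply_generated\<close> below.
\<close>

definition simply_generated :: "(nat \<Rightarrow> real) \<Rightarrow> nat \<Rightarrow> ptree pmf" where
  "simply_generated w n = embed_pmf (\<lambda>T.
     if T \<in> trees_of_size n then weight w T / (\<Sum>T' \<in> trees_of_size n. weight w T') else 0)"

text \<open>
  The law of the indicator "a uniformly random node of the random tree with \<open>n\<close> nodes is protected":
  first draw the tree, then, given the tree, a node uniformly at random.
\<close>

definition random_node_protected :: "(nat \<Rightarrow> real) \<Rightarrow> nat \<Rightarrow> bool pmf" where
  "random_node_protected w n =
     bind_pmf (simply_generated w n) (\<lambda>T.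
       map_pmf (\<lambda>i. is_protected (nodes T ! i)) (pmf_of_set {..<tree_size T}))"

lemma tree_size_Node: "tree_size (Node ts) = Suc (\<Sum>t\<leftarrow>ts. tree_size t)"
  by (simp add: tree_size_def length_concat comp_def)

lemma tree_size_pos: "tree_size T > 0"
  by (cases T) (simp add: tree_size_Node)

lemma finite_tree_size_le: "finite {T. tree_size T \<le> n}"
proof (induction n)
  case 0
  have "{T. tree_size T \<le> 0} = {}"
    using tree_size_pos by auto
  then show ?case by (metis finite.emptyI)
next
  case (Suc n)
  let ?A = "{T. tree_size T \<le> n}"
  have "T \<in> Node ` {ts. set ts \<subseteq> ?A \<and> length ts \<le> n}" if "tree_size T \<le> Suc n" for T
  proof -
    obtain ts where T: "T = Node ts" by (cases T)
    have sum: "(\<Sum>t\<leftarrow>ts. tree_size t) \<le> n"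
      using that by (simp add: T tree_size_Node)
    have "set ts \<subseteq> ?A"
      using sum member_le_sum_list[of _ "map tree_size ts"] by fastforce
    moreover have "length ts \<le> (\<Sum>t\<leftarrow>ts. tree_size t)"
    proof (induction ts)
      case (Cons t ts)
      then show ?case using tree_size_pos[of t] by simp
    qed simp
    ultimately show ?thesis using sum T by auto
  qed
  then have "{T. tree_size T \<le> Suc n} \<subseteq> Node ` {ts. set ts \<subseteq> ?A \<and> length ts \<le> n}"
    by blast
  then show ?case
    using finite_lists_length_le[OF Suc.IH] finite_subset by blast
qed

lemma finite_trees_of_size: "finite (trees_of_size n)"
  by (rule finite_subset[OF _ finite_tree_size_le[of n]]) (auto simp: trees_of_size_def)

lemma weight_nonneg: "(\<And>k. w k \<ge> 0) \<Longrightarrow> weight w T \<ge> 0"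
  unfolding weight_def by (rule prod_list_nonneg) auto

lemma pmf_simply_generated:
  assumes "\<And>k. w k \<ge> 0" and "n \<in> admissible w"
  shows "pmf (simply_generated w n) T =
    (if T \<in> trees_of_size n then weight w T / (\<Sum>T' \<in> trees_of_size n. weight w T') else 0)"
proof -
  let ?Z = "\<Sum>T' \<in> trees_of_size n. weight w T'"
  let ?f = "\<lambda>T. if T \<in> trees_of_size n then weight w T / ?Z else 0"
  obtain T0 where T0: "T0 \<in> trees_of_size n" "weight w T0 > 0"
    using assms(2) by (auto simp: admissible_def)
  have nn: "weight w T \<ge> 0" for T
    using weight_nonneg assms(1) by blast
  have Z: "?Z > 0"
    by (rule sum_pos2[where f = "weight w", OF finite_trees_of_size T0 nn])
  have f_nn: "?f T \<ge> 0" for T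
    using nn Z by simp
  have "(\<integral>\<^sup>+T. ennreal (?f T) \<partial>count_space UNIV) = (\<Sum>T \<in> trees_of_size n. ennreal (?f T))"
    by (rule nn_integral_count_space'[OF finite_trees_of_size]) auto
  also have "\<dots> = ennreal (\<Sum>T \<in> trees_of_size n. ?f T)"
    using f_nn by (intro sum_ennreal)
  also have "(\<Sum>T \<in> trees_of_size n. ?f T) = 1"
    using Z by (simp flip: sum_divide_distrib)
  finally show ?thesis
    unfolding simply_generated_def using f_nn by (subst pmf_embed_pmf) auto
qed

section \<open>The parameter \<open>\<tau>\<close> and the limit\<close>

definition gen_fun :: "(nat \<Rightarrow> real) \<Rightarrow> real \<Rightarrow> real" where
  "gen_fun a t = (\<Sum>k. a k * t ^ k)"

text \<open>
  \<open>t\<close> lies in \<open>[0, \<rho>]\<close> and \<open>t * \<Phi>'(t) = \<Phi>(t) < \<infinity>\<close>.  The coefficients of \<open>\<Phi>'\<close> are \<open>diffs w\<close>; at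
  \<open>t = \<rho>\<close> the value \<open>\<Phi>'(\<rho>)\<close> is the sum of that series.  As \<open>w\<close> is non-negative, summability
  expresses finiteness of \<open>\<Phi>(t)\<close> and \<open>\<Phi>'(t)\<close>.
\<close>

definition tau_equation :: "(nat \<Rightarrow> real) \<Rightarrow> real \<Rightarrow> bool" where
  "tau_equation w t \<longleftrightarrow>
     0 \<le> t \<and> ereal t \<le> conv_radius w \<and>
     summable (\<lambda>k. w k * t ^ k) \<and> summable (\<lambda>k. diffs w k * t ^ k) \<and>
     t * gen_fun (diffs w) t = gen_fun w t"

text \<open>
  Only finite \<open>\<tau>\<close> is needed: \<open>\<tau> = \<infinity>\<close> together with \<open>\<Phi>(\<tau>) < \<infinity>\<close> would force \<open>w k = 0\<close> for all
  \<open>k \<ge> 1\<close>, so that no tree with more than one node has positive weight.  The solution of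
  \<open>tau_equation w\<close> is unique unless \<open>w k = 0\<close> for all \<open>k \<noteq> 1\<close>, when no tree has positive weight.
\<close>

definition is_tau :: "(nat \<Rightarrow> real) \<Rightarrow> real \<Rightarrow> bool" where
  "is_tau w \<tau> \<longleftrightarrow>
     (if \<exists>t. tau_equation w t then tau_equation w \<tau> else ereal \<tau> = conv_radius w)"

definition tilted :: "(nat \<Rightarrow> real) \<Rightarrow> real \<Rightarrow> nat \<Rightarrow> real" where
  "tilted w \<tau> k = w k * \<tau> ^ k / gen_fun w \<tau>"

definition p_star :: "(nat \<Rightarrow> real) \<Rightarrow> real \<Rightarrow> real" where
  "p_star w \<tau> = gen_fun (tilted w \<tau>) (1 - tilted w \<tau> 0) - tilted w \<tau> 0"

end

theory Submission
  imports Defs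
begin

text \<open>
  If \<open>\<tau> > 0\<close>, the weights may be replaced by the probability weights \<open>\<pi>\<close>, which do not change the
  random tree. A supersolution of the recursion for the generating function of trees weighted with
  \<open>exp \<theta>\<close> per protected node shows that the total weight of the trees with \<open>n\<close> nodes whose
  proportion of protected nodes is off by more than \<open>\<epsilon>\<close> is exponentially small. The partition
  function \<open>Z\<^sub>n\<close>, on the other hand, decays subexponentially: grafting one tree onto another makes it
  supermultiplicative, so otherwise \<open>y = \<Sum>\<^sub>n Z\<^sub>n x\<^sup>n\<close> would converge for some \<open>x > 1\<close>, and
  \<open>x \<Phi>\<^sub>\<tau>(y) \<le> y\<close> contradicts the choice of \<open>\<tau>\<close>, by which the tangent of \<open>\<Phi>\<^sub>\<tau>\<close> at \<open>1\<close> gives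
  \<open>\<Phi>\<^sub>\<tau>(y) \<ge> y\<close>.

  If \<open>\<tau> = \<rho> = 0\<close>, the same argument shows that \<open>Z\<^sub>n\<close> grows superexponentially. Contracting all
  nodes of small positive outdegree loses only an exponential factor in weight and multiplicity but
  removes a positive fraction of the tree, so by supermultiplicativity trees with a positive
  fraction of internal nodes are negligible.
\<close>

subsection \<open>Degree sequences\<close>

text \<open>The Lukasiewicz word of the tree: outdegrees in preorder. It determines the tree, so
  grafting and contraction become operations on lists.\<close>

definition code :: "ptree \<Rightarrow> nat list" where
  "code T = map outdegree (nodes T)"

lemma code_Node: "code (Node ts) = length ts # concat (map code ts)"
  by (simp add: code_def[abs_def] outdegree_def map_concat comp_def)

lemma length_code: "length (code T) = tree_size T"
  by (simp add: code_def tree_size_def)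

lemma code_neq_Nil [simp]: "code T \<noteq> []"
  by (cases T) (simp add: code_Node)

lemma weight_code: "weight w T = prod_list (map w (code T))"
  by (simp add: weight_def code_def comp_def)

lemma weight_Node: "weight w (Node ts) = w (length ts) * (\<Prod>t\<leftarrow>ts. weight w t)"
proof -
  have "prod_list (map w (concat (map code ts))) = (\<Prod>t\<leftarrow>ts. prod_list (map w (code t)))"
    by (induction ts) auto
  then show ?thesis
    by (simp add: weight_code code_Node)
qed

text \<open>Codes are uniquely readable, none being a proper prefix of another. The tails
  \<open>xs\<close> and \<open>ys\<close> let the induction peel off one child after the
  other.\<close>

lemma code_append_inject: "code T @ xs = code T' @ ys \<Longrightarrow> T = T' \<and> xs = ys"
proof (induction T arbitrary: T' xs ys)
  case (Node ts)
  obtain ts' where T': "T' = Node ts'" by (cases T')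
  have list: "us = us' \<and> xs = ys"
    if "set us \<subseteq> set ts" "length us = length us'"
      "concat (map code us) @ xs = concat (map code us') @ ys" for us us'
    using that(2,1,3)
  proof (induction us us' rule: list_induct2)
    case (Cons u us u' us')
    then have "u = u' \<and> concat (map code us) @ xs = concat (map code us') @ ys"
      using Node.IH[of u "concat (map code us) @ xs" u' "concat (map code us') @ ys"] by auto
    with Cons show ?case by auto
  qed auto
  show ?case
    using Node.prems list[of ts ts'] by (auto simp: T' code_Node)
qed

lemma inj_code: "inj code"
  using code_append_inject[of _ "[]" _ "[]"] by (auto intro: injI)

lemma last_code: "last (code T) = 0"
proof (induction T)
  case (Node ts)
  show ?case
  proof (cases ts rule: rev_cases)
    case (snoc us u)
    then show ?thesis using Node[of u] by (simp add: code_Node)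
  qed (simp add: code_Node)
qed

lemma code_eq_snoc: "code T = butlast (code T) @ [0]"
  using append_butlast_last_id[of "code T"] by (simp add: last_code)

text \<open>Every node but the root is a child of exactly one node.\<close>

lemma sum_list_code: "Suc (sum_list (code T)) = tree_size T"
proof (induction T)
  case (Node ts)
  have "sum_list (concat (map code us)) + length us = (\<Sum>t\<leftarrow>us. tree_size t)"
    if "set us \<subseteq> set ts" for us
    using that
  proof (induction us)
    case (Cons u us)
    then have "Suc (sum_list (code u)) = tree_size u" using Node by auto
    with Cons show ?case by auto
  qed simp
  from this[of ts] show ?case by (simp add: code_Node tree_size_Node)
qed

text \<open>The last entry of \<open>code T\<close> belongs to a leaf, in place of which \<open>T'\<close> is planted.\<close>

lemma ex_graft: "\<exists>U. code U = butlast (code T) @ code T'"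
proof (induction T)
  case (Node ts)
  show ?case
  proof (cases ts rule: rev_cases)
    case (snoc us u)
    then obtain U where "code U = butlast (code u) @ code T'"
      using Node[of u] by auto
    then have "code (Node (us @ [U])) = butlast (code (Node ts)) @ code T'"
      by (simp add: snoc code_Node butlast_append)
    then show ?thesis by blast
  qed (auto simp: code_Node)
qed

definition graft :: "ptree \<Rightarrow> ptree \<Rightarrow> ptree" where
  "graft T T' = (SOME U. code U = butlast (code T) @ code T')"

lemma code_graft: "code (graft T T') = butlast (code T) @ code T'"
  unfolding graft_def by (rule someI_ex) (rule ex_graft)

lemma tree_size_graft: "Suc (tree_size (graft T T')) = tree_size T + tree_size T'"
  using tree_size_pos[of T] by (simp add: code_graft flip: length_code)

text \<open>Planting \<open>T'\<close> destroys one leaf of \<open>T\<close>, for which the factor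
  \<open>w 0\<close> compensates.\<close>

lemma weight_graft: "weight w (graft T T') * w 0 = weight w T * weight w T'"
proof -
  have "weight w T = prod_list (map w (butlast (code T))) * w 0"
    unfolding weight_code by (subst code_eq_snoc) simp
  then show ?thesis by (simp add: weight_code code_graft)
qed

text \<open>The size of the lower tree tells where to cut the code of the graft.\<close>

lemma graft_inject:
  assumes "graft T U = graft T' U'" and "tree_size T = tree_size T'"
  shows "T = T' \<and> U = U'"
proof -
  have "butlast (code T) @ code U = butlast (code T') @ code U'"
    using assms(1) by (metis code_graft)
  moreover have "length (butlast (code T)) = length (butlast (code T'))"
    using assms(2) by (simp add: length_code)
  ultimately have "butlast (code T) = butlast (code T')" "code U = code U'"
    by auto
  then show ?thesis
    using code_eq_snoc[of T] code_eq_snoc[of T'] injD[OF inj_code] by metis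
qed

subsection \<open>The partition function\<close>

definition partition_fun :: "(nat \<Rightarrow> real) \<Rightarrow> nat \<Rightarrow> real" where
  "partition_fun w n = (\<Sum>T \<in> trees_of_size n. weight w T)"

lemma partition_fun_nonneg: "(\<And>k. w k \<ge> 0) \<Longrightarrow> partition_fun w n \<ge> 0"
  unfolding partition_fun_def by (intro sum_nonneg weight_nonneg)

lemma partition_fun_pos_iff:
  assumes "\<And>k. w k \<ge> 0"
  shows "partition_fun w n > 0 \<longleftrightarrow> n \<in> admissible w"
proof -
  have nn: "weight w T \<ge> 0" for T using weight_nonneg assms by blast
  have "partition_fun w n = 0 \<longleftrightarrow> (\<forall>T\<in>trees_of_size n. weight w T = 0)"
    unfolding partition_fun_def by (rule sum_nonneg_eq_0_iff[OF finite_trees_of_size nn])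
  then show ?thesis
    using partition_fun_nonneg[where w=w and n=n, OF assms] nn
    by (auto simp: admissible_def less_le) 
qed

text \<open>Grafting is injective on pairs of prescribed sizes and merges a leaf with a root, whence
  \<open>w 0\<close> and the size \<open>Suc (a + b)\<close>.\<close>

lemma partition_fun_supermult:
  assumes "\<And>k. w k \<ge> 0"
  shows "partition_fun w (Suc a) * partition_fun w (Suc b)
    \<le> w 0 * partition_fun w (Suc (a + b))"
proof -
  let ?P = "trees_of_size (Suc a) \<times> trees_of_size (Suc b)"
  have inj: "inj_on (\<lambda>(T, U). graft T U) ?P"
    by (rule inj_onI) (auto simp: trees_of_size_def dest: graft_inject)
  have sub: "(\<lambda>(T, U). graft T U) ` ?P \<subseteq> trees_of_size (Suc (a + b))"
  proof clarify
    fix T U assume "T \<in> trees_of_size (Suc a)" "U \<in> trees_of_size (Suc b)"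
    then show "graft T U \<in> trees_of_size (Suc (a + b))"
      using tree_size_graft[of T U] by (auto simp: trees_of_size_def)
  qed
  have "partition_fun w (Suc a) * partition_fun w (Suc b)
      = (\<Sum>(T, U) \<in> ?P. weight w T * weight w U)"
    by (simp add: partition_fun_def sum_product sum.cartesian_product)
  also have "\<dots> = (\<Sum>(T, U) \<in> ?P. w 0 * weight w (graft T U))"
    by (intro sum.cong) (auto simp: weight_graft[symmetric])
  also have "\<dots> = (\<Sum>T \<in> (\<lambda>(T, U). graft T U) ` ?P. w 0 * weight w T)"
    by (subst sum.reindex[OF inj]) (simp add: comp_def case_prod_unfold)
  also have "\<dots> \<le> (\<Sum>T \<in> trees_of_size (Suc (a + b)). w 0 * weight w T)"
    using assms by (intro sum_mono2[OF finite_trees_of_size sub] mult_nonneg_nonneg weight_nonneg) auto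
  finally show ?thesis by (simp add: partition_fun_def sum_distrib_left)
qed

text \<open>Every tree has a leaf.\<close>

lemma admissible_imp_weight_0_pos:
  assumes "\<And>k. w k \<ge> 0" and "n \<in> admissible w"
  shows "w 0 > 0"
proof (rule ccontr)
  assume "\<not> w 0 > 0"
  then have "w 0 = 0" using assms(1)[of 0] by linarith
  then have "weight w T = 0" for T
    unfolding weight_code by (subst code_eq_snoc) simp
  then show False using assms(2) by (auto simp: admissible_def)
qed

lemma weight_leaf: "weight w (Node []) = w 0"
  by (simp add: weight_Node)

lemma tree_size_eq_1_iff: "tree_size T = 1 \<longleftrightarrow> T = Node []"
proof (cases T)
  case (Node ts)
  have "(\<Sum>t\<leftarrow>ts. tree_size t) = 0 \<longleftrightarrow> ts = []"
    using tree_size_pos by (cases ts) auto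
  then show ?thesis by (simp add: Node tree_size_Node)
qed

lemma partition_fun_1: "partition_fun w 1 = w 0"
proof -
  have "trees_of_size 1 = {Node []}"
    unfolding trees_of_size_def tree_size_eq_1_iff by simp
  then show ?thesis by (simp add: partition_fun_def weight_leaf)
qed

lemma partition_fun_0: "partition_fun w 0 = 0"
proof -
  have "trees_of_size 0 = {}"
    using tree_size_pos by (auto simp: trees_of_size_def)
  then show ?thesis by (simp add: partition_fun_def)
qed

lemma admissible_add:
  assumes "\<And>k. w k \<ge> 0" and "Suc a \<in> admissible w" "Suc b \<in> admissible w"
  shows "Suc (a + b) \<in> admissible w"
proof -
  have "0 < partition_fun w (Suc a) * partition_fun w (Suc b)"
    using assms by (simp add: partition_fun_pos_iff)
  then have "0 < w 0 * partition_fun w (Suc (a + b))"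
    using partition_fun_supermult[where w=w and a=a and b=b] assms(1) by fastforce
  then show ?thesis
    using assms(1) by (metis partition_fun_pos_iff zero_less_mult_pos assms(2)
        admissible_imp_weight_0_pos)
qed

lemma admissible_star:
  assumes "w 0 > 0" "w d > 0"
  shows "Suc d \<in> admissible w"
  unfolding admissible_def trees_of_size_def
  using assms
  by (auto intro!: exI[of _ "Node (replicate d (Node []))"]
      simp: tree_size_Node weight_Node weight_leaf sum_list_replicate)

text \<open>Fekete's argument, in each residue class modulo \<open>a\<close> separately.\<close>

lemma partition_fun_lower_bound:
  assumes nonneg: "\<And>k. w k \<ge> 0" and a: "a \<ge> 1" and \<gamma>: "\<gamma> > 0"
    and large: "partition_fun w (Suc a) \<ge> w 0 * \<gamma> ^ a"
  shows "\<exists>c>0. \<forall>n \<in> admissible w. partition_fun w n \<ge> c * \<gamma> ^ n"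
proof (cases "admissible w = {}")
  case False
  then have w0: "w 0 > 0" using admissible_imp_weight_0_pos nonneg by blast
  \<comment> \<open>The shifted sizes \<open>s = n - 1\<close> add under grafting.
    \<open>m r\<close> is the least of them in the class \<open>r\<close> modulo \<open>a\<close>;
    the others in the class exceed it by multiples of \<open>a\<close>.\<close>
  define A where "A r = {s. Suc s \<in> admissible w \<and> s mod a = r}" for r
  define m where "m r = (LEAST s. s \<in> A r)" for r
  define R where "R = {r. r < a \<and> A r \<noteq> {}}"
  have fin: "finite R" by (simp add: R_def)
  have mA: "m r \<in> A r" if "r \<in> R" for r
    using that unfolding m_def R_def by (auto intro: LeastI)
  define q where "q r = partition_fun w (Suc (m r)) / \<gamma> ^ m r" for r
  have q_pos: "q r > 0" if "r \<in> R" for r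
    using mA[OF that] nonneg \<gamma> by (auto simp: q_def A_def partition_fun_pos_iff)
  \<comment> \<open>Trees with \<open>Suc a\<close> nodes are planted \<open>i\<close> times; the
    factor \<open>w 0\<close> in \<open>large\<close> pays for the lost leaves.\<close>
  have step: "partition_fun w (Suc (s + i * a)) \<ge> partition_fun w (Suc s) * \<gamma> ^ (i * a)" for s i
  proof (induction i)
    case (Suc i)
    have "w 0 * (partition_fun w (Suc s) * \<gamma> ^ (Suc i * a))
        = (partition_fun w (Suc s) * \<gamma> ^ (i * a)) * (w 0 * \<gamma> ^ a)"
      by (simp add: power_add algebra_simps)
    also have "\<dots> \<le> partition_fun w (Suc (s + i * a)) * partition_fun w (Suc a)"
      using Suc large \<gamma> w0 partition_fun_nonneg[OF nonneg] by (intro mult_mono) auto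
    also have "\<dots> \<le> w 0 * partition_fun w (Suc (s + Suc i * a))"
      using partition_fun_supermult[OF nonneg, where a="s + i * a" and b=a] by (simp add: add_ac)
    finally show ?case using w0 by simp
  qed simp
  \<comment> \<open>Division by \<open>\<gamma>\<close> passes from the exponent
    \<open>n - 1\<close> to \<open>n\<close>; the inserted 1 keeps \<open>Min\<close> meaningful for
    empty \<open>R\<close>.\<close>
  define c where "c = Min (insert 1 (q ` R)) / \<gamma>"
  have "c > 0" using fin q_pos \<gamma> by (auto simp: c_def)
  moreover have "partition_fun w n \<ge> c * \<gamma> ^ n" if adm: "n \<in> admissible w" for n
  proof -
    obtain s where n: "n = Suc s"
      using adm partition_fun_0[of w] partition_fun_pos_iff[where w=w and n=0, OF nonneg]
      by (cases n) auto
    define r where "r = s mod a"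
    have sA: "s \<in> A r" using adm n by (auto simp: A_def r_def)
    then have r: "r \<in> R" using a by (auto simp: R_def r_def)
    have "m r \<le> s" using sA unfolding m_def by (rule Least_le)
    moreover have "m r mod a = s mod a" using mA[OF r] by (auto simp: A_def r_def)
    ultimately obtain i where i: "s = m r + i * a"
      by (metis mod_eq_dvd_iff_nat dvd_def le_add_diff_inverse mult.commute)
    have "c * \<gamma> \<le> q r" using fin r \<gamma> by (auto simp: c_def)
    then have "c * \<gamma> ^ n \<le> q r * \<gamma> ^ s"
      using \<gamma> by (simp add: n mult.assoc[symmetric])
    also have "\<dots> = partition_fun w (Suc (m r)) * \<gamma> ^ (i * a)"
      using \<gamma> by (simp add: q_def i power_add)
    also have "\<dots> \<le> partition_fun w n" using step[of "m r" i] by (simp add: n i)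
    finally show ?thesis .
  qed
  ultimately show ?thesis by blast
qed (auto intro: exI[of _ 1])

subsection \<open>Recursion for weighted sums over trees\<close>

lemma Suc_length_le_tree_size: "Suc (length ts) \<le> tree_size (Node ts)"
proof (induction ts)
  case (Cons t ts)
  then show ?case using tree_size_pos[of t] by (simp add: tree_size_Node)
qed (simp add: tree_size_Node)

lemma tree_size_member: "t \<in> set ts \<Longrightarrow> tree_size t < tree_size (Node ts)"
  using member_le_sum_list[of "tree_size t" "map tree_size ts"] by (simp add: tree_size_Node)

lemma sum_lists_prod_list:
  fixes f :: "'a \<Rightarrow> 'b::comm_semiring_1"
  assumes "finite A"
  shows "(\<Sum>xs \<in> {xs. set xs \<subseteq> A \<and> length xs = k}. \<Prod>x\<leftarrow>xs. f x) = (\<Sum>x\<in>A. f x) ^ k"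
proof (induction k)
  case 0
  have "{xs. set xs \<subseteq> A \<and> length xs = 0} = {[]}" by auto
  then show ?case by simp
next
  case (Suc k)
  let ?L = "\<lambda>k. {xs. set xs \<subseteq> A \<and> length xs = k}"
  have "?L (Suc k) = (\<lambda>(x, xs). x # xs) ` (A \<times> ?L k)"
    by (auto simp: length_Suc_conv image_iff)
  moreover have "inj_on (\<lambda>(x, xs). x # xs) (A \<times> ?L k)" by (auto intro: inj_onI)
  ultimately have "(\<Sum>xs\<in>?L (Suc k). \<Prod>x\<leftarrow>xs. f x)
      = (\<Sum>(x, xs) \<in> A \<times> ?L k. f x * (\<Prod>x\<leftarrow>xs. f x))"
    by (simp add: sum.reindex comp_def case_prod_unfold)
  also have "\<dots> = (\<Sum>x\<in>A. f x) * (\<Sum>xs\<in>?L k. \<Prod>x\<leftarrow>xs. f x)"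
    by (simp add: sum_product sum.cartesian_product)
  finally show ?case by (simp add: Suc)
qed

lemma power_prod_list:
  fixes x :: "'a::comm_monoid_mult"
  shows "(\<Prod>t\<leftarrow>ts. x ^ f t) = x ^ (\<Sum>t\<leftarrow>ts. f t)"
  by (induction ts) (auto simp: power_add)

lemma prod_list_mult:
  fixes f g :: "'b \<Rightarrow> 'a::comm_monoid_mult"
  shows "(\<Prod>t\<leftarrow>ts. f t * g t) = (\<Prod>t\<leftarrow>ts. f t) * (\<Prod>t\<leftarrow>ts. g t)"
  by (induction ts) (auto simp: ac_simps)

text \<open>The generating function \<open>y\<close> of the weighted trees satisfies \<open>y = x \<Phi>(y)\<close>; the inequality
  below is all that is needed.\<close>

lemma tree_gen_fun_le:
  assumes nonneg: "\<And>k. w k \<ge> 0" and x: "x > 0"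
    and sm: "summable (\<lambda>n. partition_fun w n * x ^ n)"
  defines "y \<equiv> \<Sum>n. partition_fun w n * x ^ n"
  shows "summable (\<lambda>k. w k * y ^ k)" and "x * gen_fun w y \<le> y"
proof -
  define g where "g T = weight w T * x ^ tree_size T" for T
  define Y where "Y N = (\<Sum>T | tree_size T \<le> N. g T)" for N
  have g_nn: "g T \<ge> 0" for T using weight_nonneg[OF nonneg] x by (simp add: g_def)
  have Y_eq: "Y N = (\<Sum>n\<le>N. partition_fun w n * x ^ n)" for N
  proof -
    have "Y N = (\<Sum>n\<le>N. \<Sum>T | T \<in> {T. tree_size T \<le> N} \<and> tree_size T = n. g T)"
      unfolding Y_def by (rule sum.group[symmetric]) (auto simp: finite_tree_size_le)
    also have "\<dots> = (\<Sum>n\<le>N. partition_fun w n * x ^ n)"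
      unfolding partition_fun_def trees_of_size_def g_def sum_distrib_right
      by (intro sum.cong) auto
    finally show ?thesis .
  qed
  have lim: "Y \<longlonglongrightarrow> y"
    unfolding Y_eq[abs_def] y_def using summable_LIMSEQ'[OF sm] .
  have Y_le: "Y N \<le> y" for N
    unfolding Y_eq y_def using sm x partition_fun_nonneg[where w=w, OF nonneg]
    by (intro sum_le_suminf) auto
  \<comment> \<open>The left side is the weight of the trees with root outdegree below
    \<open>K\<close> and subtrees of size at most \<open>N\<close>. They are finitely many, so a
    later \<open>Y\<close> includes them all.\<close>
  have partial: "x * (\<Sum>k<K. w k * Y N ^ k) \<le> y" for K N
  proof -
    let ?A = "{T. tree_size T \<le> N}"
    define L where "L k = {ts. set ts \<subseteq> ?A \<and> length ts = k}" for k
    have L_fin: "finite (L k)" for k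
      unfolding L_def by (rule finite_lists_length_eq[OF finite_tree_size_le])
    have g_Node: "g (Node ts) = x * (w (length ts) * (\<Prod>t\<leftarrow>ts. g t))" for ts
      by (simp add: g_def weight_Node tree_size_Node power_prod_list prod_list_mult)
    have "x * (\<Sum>k<K. w k * Y N ^ k) = (\<Sum>k<K. \<Sum>ts\<in>L k. g (Node ts))"
      unfolding Y_def sum_lists_prod_list[OF finite_tree_size_le, symmetric] sum_distrib_left g_Node
      by (intro sum.cong) (auto simp: L_def)
    also have "\<dots> = (\<Sum>ts \<in> (\<Union>k<K. L k). g (Node ts))"
      by (rule sum.UNION_disjoint[symmetric]) (auto simp: L_fin, auto simp: L_def)
    also have "\<dots> = (\<Sum>T \<in> Node ` (\<Union>k<K. L k). g T)"
      by (subst sum.reindex) (auto intro: inj_onI)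
    also have "\<dots> \<le> Y (Max (tree_size ` Node ` (\<Union>k<K. L k)))"
      unfolding Y_def using g_nn L_fin
      by (intro sum_mono2 finite_tree_size_le) (auto intro!: Max_ge)
    also have "\<dots> \<le> y" by (rule Y_le)
    finally show ?thesis .
  qed
  \<comment> \<open>For fixed \<open>K\<close> the sum is a polynomial in \<open>Y N\<close>, so
    \<open>N\<close> can tend to infinity before convergence at \<open>y\<close> is known. The
    resulting bound then yields that convergence.\<close>
  have y_partial: "x * (\<Sum>k<K. w k * y ^ k) \<le> y" for K
  proof (rule LIMSEQ_le_const2)
    show "(\<lambda>N. x * (\<Sum>k<K. w k * Y N ^ k)) \<longlonglongrightarrow> x * (\<Sum>k<K. w k * y ^ k)"
      by (intro tendsto_intros lim)
  qed (use partial in auto)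
  have "y \<ge> 0" using Y_le[of 0] sum_nonneg[of "{T. tree_size T \<le> 0}" g] g_nn
    by (auto simp: Y_def intro: order_trans)
  then show sum: "summable (\<lambda>k. w k * y ^ k)"
    using y_partial x nonneg
    by (intro summableI_nonneg_bounded[where x="y / x"]) (auto simp: field_simps)
  have "(\<lambda>K. x * (\<Sum>k<K. w k * y ^ k)) \<longlonglongrightarrow> x * gen_fun w y"
    unfolding gen_fun_def by (intro tendsto_intros summable_LIMSEQ sum)
  then show "x * gen_fun w y \<le> y"
    by (rule LIMSEQ_le_const2) (use y_partial in auto)
qed

text \<open>Either some \<open>a\<close> starts Fekete's argument, or the partition function is at
  most geometric with ratio \<open>\<gamma>\<close>. In the latter case its generating function
  converges at \<open>x\<close>, as \<open>\<gamma> * x < 1\<close>, and its value \<open>y\<close>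
  there violates \<open>not_le\<close>.\<close>

lemma partition_fun_growth:
  assumes nonneg: "\<And>k. w k \<ge> 0" and "w 0 > 0" and \<gamma>: "\<gamma> > 0"
    and x: "x > 0" "\<gamma> * x < 1"
    and not_le: "\<And>y. y > 0 \<Longrightarrow> summable (\<lambda>k. w k * y ^ k) \<Longrightarrow> \<not> x * gen_fun w y \<le> y"
  shows "\<exists>c>0. \<forall>n \<in> admissible w. partition_fun w n \<ge> c * \<gamma> ^ n"
proof (cases "\<exists>a\<ge>1. partition_fun w (Suc a) \<ge> w 0 * \<gamma> ^ a")
  case True
  then show ?thesis using partition_fun_lower_bound[where w=w, OF nonneg _ \<gamma>] by blast
next
  case False
  have le: "partition_fun w n \<le> w 0 / \<gamma> * \<gamma> ^ n" for n
  proof (cases n)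
    case 0
    then show ?thesis using \<open>w 0 > 0\<close> \<gamma> by (simp add: partition_fun_0)
  next
    case (Suc a)
    have "partition_fun w (Suc a) \<le> w 0 * \<gamma> ^ a"
    proof (cases "a \<ge> 1")
      case True
      with False show ?thesis by (metis linear)
    next
      case False
      then have "a = 0" by simp
      then show ?thesis using partition_fun_1[of w] by simp
    qed
    then show ?thesis using \<gamma> by (simp add: Suc)
  qed
  have nn: "partition_fun w n * x ^ n \<ge> 0" for n
    using partition_fun_nonneg[where w=w, OF nonneg] x by simp
  have sm: "summable (\<lambda>n. partition_fun w n * x ^ n)"
  proof (rule summable_comparison_test')
    show "summable (\<lambda>n. w 0 / \<gamma> * (\<gamma> * x) ^ n)"
      using x \<gamma> by (intro summable_mult summable_geometric) auto
    show "norm (partition_fun w n * x ^ n) \<le> w 0 / \<gamma> * (\<gamma> * x) ^ n" for n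
      using mult_right_mono[OF le[of n], of "x ^ n"] nn[of n] x
      by (simp add: power_mult_distrib mult.assoc)
  qed
  define y where "y = (\<Sum>n. partition_fun w n * x ^ n)"
  have "y > 0"
    unfolding y_def using suminf_pos_iff[OF sm nn] x \<open>w 0 > 0\<close> partition_fun_1[of w]
    by (auto intro!: exI[of _ 1])
  then show ?thesis
    using not_le tree_gen_fun_le[where w=w, OF nonneg x(1) sm] by (auto simp: y_def)
qed

section \<open>Exponential moments of the number of protected nodes\<close>

lemma num_protected_Node:
  "num_protected (Node ts) = (if ts \<noteq> [] \<and> (\<forall>t\<in>set ts. \<not> is_leaf t) then 1 else 0)
    + (\<Sum>t\<leftarrow>ts. num_protected t)"
proof -
  have "length (filter is_protected (concat (map nodes ts))) = (\<Sum>t\<leftarrow>ts. num_protected t)"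
    by (induction ts) (auto simp: num_protected_def)
  then show ?thesis
    by (simp add: num_protected_def is_protected_def is_leaf_def outdegree_def)
qed

text \<open>As a polynomial in \<open>y\<close> the difference has non-negative coefficients. With
  \<open>l\<close> the weight of a leaf and \<open>y\<close> that of the other trees, it is the
  weight of the lists of \<open>d\<close> children that contain a leaf.\<close>

lemma diff_power_mono:
  fixes l y v :: real
  assumes "0 \<le> l" "0 \<le> y" "y \<le> v"
  shows "(l + y) ^ d - y ^ d \<le> (l + v) ^ d - v ^ d"
proof (induction d)
  case (Suc d)
  have "(l + y) ^ Suc d - y ^ Suc d = (l + y) * ((l + y) ^ d - y ^ d) + l * y ^ d"
    by (simp add: algebra_simps)
  also have "\<dots> \<le> (l + v) * ((l + v) ^ d - v ^ d) + l * v ^ d"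
    using assms Suc by (intro add_mono mult_mono power_mono) (auto intro: power_mono)
  also have "\<dots> = (l + v) ^ Suc d - v ^ Suc d"
    by (simp add: algebra_simps)
  finally show ?case .
qed simp

text \<open>\<open>v\<close> bounds the generating function of the trees other than a leaf, with the weight
  \<open>exp \<theta>\<close> for each protected node, evaluated at \<open>1 / (1 + \<eta>)\<close>.\<close>

lemma protected_exp_moment:
  assumes nonneg: "\<And>k. p k \<ge> 0" and sums: "p sums 1"
    and \<eta>: "1 + \<eta> > 0" "1 + \<eta> \<ge> p 0"
    and v_def: "v = 1 - p 0 / (1 + \<eta>)"
    and ineq: "(exp \<theta> - 1) * (gen_fun p v - p 0) \<le> \<eta>"
  shows "(\<Sum>T \<in> trees_of_size n. weight p T * exp (\<theta> * num_protected T)) \<le> (1 + \<eta>) ^ n"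
proof -
  define x where "x = 1 / (1 + \<eta>)"
  define g where "g T = weight p T * exp (\<theta> * num_protected T) * x ^ tree_size T" for T
  define A where "A N = {T. tree_size T \<le> N \<and> \<not> is_leaf T}" for N
  have x: "x > 0" using \<eta> by (simp add: x_def)
  have v: "0 \<le> v" "v \<le> 1" using \<eta> nonneg[of 0] by (auto simp: v_def field_simps)
  have A_fin: "finite (A N)" for N
    by (rule finite_subset[OF _ finite_tree_size_le[of N]]) (auto simp: A_def)
  have g_nn: "g T \<ge> 0" for T using weight_nonneg[OF nonneg] x by (simp add: g_def)
  have leaf: "is_leaf T \<longleftrightarrow> T = Node []" for T
    by (cases T) (simp add: is_leaf_def outdegree_def)
  have g_leaf: "g (Node []) = x * p 0"
    by (simp add: g_def weight_leaf num_protected_Node tree_size_Node)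
  have g_leaf_v: "g (Node []) + v = 1"
    by (simp add: g_leaf x_def v_def)
  \<comment> \<open>Split \<open>exp \<theta>\<close> as \<open>1 + (exp \<theta> - 1)\<close>; the
    second part enters only if no child is a leaf, that is, if the root is protected.\<close>
  have g_Node: "g (Node ts) = x * (p (length ts) *
      ((\<Prod>t\<leftarrow>ts. g t) + (if \<forall>t\<in>set ts. \<not> is_leaf t then (exp \<theta> - 1) * (\<Prod>t\<leftarrow>ts. g t) else 0)))"
    if "ts \<noteq> []" for ts
  proof -
    have "(\<Prod>t\<leftarrow>us. exp (\<theta> * num_protected t)) = exp (\<theta> * (\<Sum>t\<leftarrow>us. num_protected t))" for us
      by (induction us) (auto simp: exp_add algebra_simps)
    then have "(\<Prod>t\<leftarrow>ts. g t) = (\<Prod>t\<leftarrow>ts. weight p t)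
        * exp (\<theta> * (\<Sum>t\<leftarrow>ts. num_protected t)) * x ^ (\<Sum>t\<leftarrow>ts. tree_size t)"
      unfolding g_def prod_list_mult power_prod_list by simp
    then show ?thesis
      using that by (auto simp: g_def[of "Node ts"] num_protected_Node tree_size_Node weight_Node
          exp_add algebra_simps)
  qed
  \<comment> \<open>\<open>v\<close> is a supersolution: if the non-leaf subtrees of size at most
    \<open>N\<close> weigh at most \<open>v\<close>, the recursion at the root returns at most
    \<open>v\<close>.\<close>
  have main: "(\<Sum>T\<in>A N. g T) \<le> v" for N
  proof (induction N)
    case 0
    have "A 0 = {}" using tree_size_pos by (auto simp: A_def)
    then show ?case using v by simp
  next
    case (Suc N)
    define l where "l = g (Node [])"
    define y where "y = (\<Sum>T\<in>A N. g T)"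
    have l: "l \<ge> 0" and y: "y \<ge> 0" "y \<le> v"
      using g_nn Suc by (auto simp: l_def y_def intro: sum_nonneg)
    define B where "B = insert (Node []) (A N)"
    define L where "L C k = {ts. set ts \<subseteq> C \<and> length ts = k}" for C :: "ptree set" and k
    have B_fin: "finite B" using A_fin by (simp add: B_def)
    have L_fin: "finite C \<Longrightarrow> finite (L C k)" for C k
      unfolding L_def by (rule finite_lists_length_eq)
    have sum_B: "(\<Sum>T\<in>B. g T) = l + y"
      using A_fin by (simp add: B_def l_def y_def) (simp add: A_def leaf)
    have sub: "A (Suc N) \<subseteq> Node ` (\<Union>k\<in>{1..N}. L B k)"
    proof
      fix T assume T: "T \<in> A (Suc N)"
      obtain ts where ts: "T = Node ts" by (cases T)
      have "t \<in> B" if "t \<in> set ts" for t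
        using tree_size_member[OF that] T by (auto simp: A_def B_def ts leaf)
      moreover have "length ts \<in> {1..N}"
        using T Suc_length_le_tree_size[of ts] by (cases ts) (auto simp: ts A_def leaf)
      ultimately show "T \<in> Node ` (\<Union>k\<in>{1..N}. L B k)"
        unfolding ts by (intro imageI) (auto simp: L_def)
    qed
    have level: "(\<Sum>ts\<in>L B k. g (Node ts)) \<le> x * (p k + (exp \<theta> - 1) * (p k * v ^ k))"
      if "k \<ge> 1" for k
    proof -
      have "(\<Sum>ts\<in>L B k. g (Node ts)) = (\<Sum>ts\<in>L B k. x * (p k *
          ((\<Prod>t\<leftarrow>ts. g t) + (if \<forall>t\<in>set ts. \<not> is_leaf t then (exp \<theta> - 1) * (\<Prod>t\<leftarrow>ts. g t) else 0))))"
        using that by (intro sum.cong refl, subst g_Node) (auto simp: L_def)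
      also have "\<dots> = x * (p k * ((\<Sum>ts\<in>L B k. \<Prod>t\<leftarrow>ts. g t)
          + (\<Sum>ts\<in>L B k. if \<forall>t\<in>set ts. \<not> is_leaf t then (exp \<theta> - 1) * (\<Prod>t\<leftarrow>ts. g t) else 0)))"
        unfolding sum.distrib[symmetric] sum_distrib_left ..
      also have "(\<Sum>ts\<in>L B k. \<Prod>t\<leftarrow>ts. g t) = (l + y) ^ k"
        unfolding L_def sum_B[symmetric] by (rule sum_lists_prod_list[OF B_fin])
      also have "(\<Sum>ts\<in>L B k. if \<forall>t\<in>set ts. \<not> is_leaf t then (exp \<theta> - 1) * (\<Prod>t\<leftarrow>ts. g t) else 0)
          = (\<Sum>ts\<in>L (A N) k. (exp \<theta> - 1) * (\<Prod>t\<leftarrow>ts. g t))"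
        using L_fin[OF B_fin, of k]
        by (subst sum.inter_filter[symmetric])
           (auto intro!: sum.cong simp: L_def B_def A_def leaf)
      also have "\<dots> = (exp \<theta> - 1) * y ^ k"
        unfolding L_def y_def sum_lists_prod_list[OF A_fin, symmetric] by (simp add: sum_distrib_left)
      finally have eq: "(\<Sum>ts\<in>L B k. g (Node ts))
          = x * (p k * ((l + y) ^ k + (exp \<theta> - 1) * y ^ k))" .
      \<comment> \<open>Since \<open>exp \<theta> - 1\<close> may be negative, monotonicity in
        \<open>y\<close> is applied separately to the lists with a leaf,
        \<open>(l + y) ^ k - y ^ k\<close>, and to those without,
        \<open>exp \<theta> * y ^ k\<close>. At \<open>y = v\<close> the base \<open>l + y\<close>
        becomes 1.\<close>
      have "(l + y) ^ k + (exp \<theta> - 1) * y ^ k \<le> 1 + (exp \<theta> - 1) * v ^ k"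
      proof -
        have "(l + y) ^ k - y ^ k \<le> 1 - v ^ k"
          using diff_power_mono[OF l y, of k] g_leaf_v by (simp add: l_def)
        moreover have "exp \<theta> * y ^ k \<le> exp \<theta> * v ^ k"
          using y by (intro mult_left_mono power_mono) auto
        ultimately show ?thesis unfolding left_diff_distrib mult_1 by linarith
      qed
      then have "x * (p k * ((l + y) ^ k + (exp \<theta> - 1) * y ^ k))
          \<le> x * (p k * (1 + (exp \<theta> - 1) * v ^ k))"
        using x nonneg[of k] by (intro mult_left_mono) auto
      then show ?thesis unfolding eq by (simp add: algebra_simps)
    qed
    have pv: "summable (\<lambda>k. p k * v ^ k)"
    proof (rule summable_comparison_test'[OF sums_summable[OF sums]])
      show "norm (p k * v ^ k) \<le> p k" for k
        using nonneg[of k] v by (simp add: mult_left_le power_le_one)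
    qed
    have "(\<Sum>T\<in>A (Suc N). g T) \<le> (\<Sum>T \<in> Node ` (\<Union>k\<in>{1..N}. L B k). g T)"
      using sub g_nn L_fin[OF B_fin] by (intro sum_mono2) auto
    also have "\<dots> = (\<Sum>ts \<in> (\<Union>k\<in>{1..N}. L B k). g (Node ts))"
      by (subst sum.reindex) (auto intro: inj_onI)
    also have "\<dots> = (\<Sum>k\<in>{1..N}. \<Sum>ts\<in>L B k. g (Node ts))"
      by (rule sum.UNION_disjoint) (auto simp: L_fin[OF B_fin], auto simp: L_def)
    also have "\<dots> \<le> (\<Sum>k\<in>{1..N}. x * (p k + (exp \<theta> - 1) * (p k * v ^ k)))"
      by (intro sum_mono level) auto
    also have "\<dots> = x * (\<Sum>k\<in>{..N} - {0}. p k + (exp \<theta> - 1) * (p k * v ^ k))"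
      by (simp add: sum_distrib_left) (intro sum.cong, auto)
    also have "\<dots> = x * ((\<Sum>k\<le>N. p k + (exp \<theta> - 1) * (p k * v ^ k)) - (p 0 + (exp \<theta> - 1) * p 0))"
      by (simp add: sum_diff1)
    also have "(\<Sum>k\<le>N. p k + (exp \<theta> - 1) * (p k * v ^ k))
        \<le> (\<Sum>k. p k + (exp \<theta> - 1) * (p k * v ^ k))"
    proof (rule sum_le_suminf)
      show "summable (\<lambda>k. p k + (exp \<theta> - 1) * (p k * v ^ k))"
        by (intro summable_add summable_mult pv sums_summable[OF sums])
      show "0 \<le> p k + (exp \<theta> - 1) * (p k * v ^ k)" for k
      proof -
        have "p k * v ^ k \<le> p k" "0 \<le> exp \<theta> * (p k * v ^ k)"
          using nonneg[of k] v by (auto simp: mult_left_le power_le_one)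
        then show ?thesis by (simp add: algebra_simps)
      qed
    qed auto
    also have "\<dots> = 1 + (exp \<theta> - 1) * gen_fun p v"
      unfolding gen_fun_def using sums_unique[OF sums]
      by (subst suminf_add[symmetric])
         (auto intro: summable_mult pv sums_summable[OF sums] simp: suminf_mult[OF pv])
    finally have "(\<Sum>T\<in>A (Suc N). g T)
        \<le> x * (1 + (exp \<theta> - 1) * gen_fun p v - (p 0 + (exp \<theta> - 1) * p 0))"
      using x by simp
    also have "\<dots> = x * (1 - p 0 + (exp \<theta> - 1) * (gen_fun p v - p 0))"
      by (simp add: algebra_simps)
    also have "\<dots> \<le> x * (1 - p 0 + \<eta>)"
      using x ineq by simp
    also have "\<dots> = v" using \<eta> by (simp add: x_def v_def field_simps)
    finally show ?case .
  qed
  have "x ^ n * (\<Sum>T \<in> trees_of_size n. weight p T * exp (\<theta> * num_protected T))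
      = (\<Sum>T \<in> trees_of_size n. g T)"
    unfolding g_def sum_distrib_left by (intro sum.cong) (auto simp: trees_of_size_def)
  also have "\<dots> \<le> (\<Sum>T \<in> insert (Node []) (A n). g T)"
    using A_fin g_nn by (intro sum_mono2) (auto simp: trees_of_size_def A_def leaf)
  also have "\<dots> \<le> g (Node []) + v"
    using main[of n] A_fin g_nn by (subst sum.insert) (auto simp: A_def leaf)
  finally have "x ^ n * (\<Sum>T \<in> trees_of_size n. weight p T * exp (\<theta> * num_protected T)) \<le> 1"
    by (simp add: g_leaf_v)
  then show ?thesis
    using \<eta> by (simp add: x_def power_one_over field_simps)
qed

text \<open>The tangent of the generating function at 1 has slope \<open>\<mu>\<close>. For
  \<open>\<mu> = 1\<close> it is the diagonal. For \<open>\<mu> < 1\<close> the series diverges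
  beyond 1, and up to 1 the tangent is above the diagonal. So the function is at least
  \<open>y\<close> wherever it converges.\<close>

lemma partition_fun_growth_prob:
  assumes nonneg: "\<And>k. p k \<ge> 0" and sums: "p sums 1" and p0: "p 0 > 0"
    and mean: "(\<lambda>k. real k * p k) sums \<mu>" "\<mu> \<le> 1"
    and crit: "\<mu> = 1 \<or> (\<forall>t>1. \<not> summable (\<lambda>k. p k * t ^ k))"
    and \<gamma>: "0 < \<gamma>" "\<gamma> < 1"
  shows "\<exists>c>0. \<forall>n \<in> admissible p. partition_fun p n \<ge> c * \<gamma> ^ n"
\<comment> \<open>This \<open>x\<close> is the midpoint of 1 and \<open>1 / \<gamma>\<close>:
  \<open>x > 1\<close> contradicts \<open>gen_fun p y \<ge> y\<close>, and
  \<open>x < 1 / \<gamma>\<close> gives \<open>\<gamma> * x < 1\<close>.\<close>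
proof (rule partition_fun_growth[where w=p, OF nonneg p0 \<gamma>(1), of "(1 + 1 / \<gamma>) / 2"])
  let ?x = "(1 + 1 / \<gamma>) / 2"
  have x1: "?x > 1" using \<gamma> by (simp add: field_simps)
  show "?x > 0" "\<gamma> * ?x < 1" using \<gamma> by (auto simp: field_simps)
  show "\<not> ?x * gen_fun p y \<le> y" if y: "y > 0" and sm: "summable (\<lambda>k. p k * y ^ k)" for y
  proof -
    have s1: "(\<lambda>k. p k + real k * p k * (y - 1)) sums (1 + \<mu> * (y - 1))"
      by (intro sums_add sums sums_mult2 mean)
    have le: "p k + real k * p k * (y - 1) \<le> p k * y ^ k" for k
      using mult_left_mono[OF Bernoulli_inequality[of "y - 1" k] nonneg[of k]] y
      by (simp add: algebra_simps)
    have "1 + \<mu> * (y - 1) \<le> gen_fun p y"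
      unfolding gen_fun_def by (rule sums_le[OF le s1 summable_sums[OF sm]])
    moreover have "y \<le> 1 + \<mu> * (y - 1)"
    proof (cases "\<mu> = 1")
      case False
      then have "y \<le> 1" using crit sm by (meson not_le)
      then have "(1 - \<mu>) * (1 - y) \<ge> 0" using mean(2) by simp
      then show ?thesis by (simp add: algebra_simps)
    qed simp
    ultimately have "y \<le> gen_fun p y" by simp
    moreover have "1 * gen_fun p y < ?x * gen_fun p y"
      using x1 y calculation by (intro mult_strict_right_mono) auto
    ultimately show ?thesis by simp
  qed
qed

text \<open>The series converges at no \<open>y > 0\<close>, so any positive \<open>x\<close> below
  \<open>1 / \<gamma>\<close> serves, and \<open>\<gamma>\<close> can be arbitrarily large.\<close>

lemma partition_fun_growth_radius_0:
  assumes nonneg: "\<And>k. w k \<ge> 0" and "w 0 > 0" and "conv_radius w = 0" and \<gamma>: "\<gamma> > 0"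
  shows "\<exists>c>0. \<forall>n \<in> admissible w. partition_fun w n \<ge> c * \<gamma> ^ n"
proof (rule partition_fun_growth[where w=w, OF nonneg \<open>w 0 > 0\<close> \<gamma>, of "1 / (2 * \<gamma>)"])
  show "1 / (2 * \<gamma>) > 0" "\<gamma> * (1 / (2 * \<gamma>)) < 1" using \<gamma> by auto
  show "\<not> 1 / (2 * \<gamma>) * gen_fun w y \<le> y"
    if "y > 0" "summable (\<lambda>k. w k * y ^ k)" for y
    using conv_radius_geI[OF that(2)] that(1) \<open>conv_radius w = 0\<close> by simp
qed

subsection \<open>Exponential concentration\<close>

lemma prob_simply_generated:
  assumes nonneg: "\<And>k. w k \<ge> 0" and n: "n \<in> admissible w"
  shows "measure_pmf.prob (simply_generated w n) {T. P T}
    = (\<Sum>T | T \<in> trees_of_size n \<and> P T. weight w T) / partition_fun w n"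
proof -
  let ?M = "simply_generated w n"
  note pmf = pmf_simply_generated[where w=w, OF nonneg n]
  have set: "set_pmf ?M \<subseteq> trees_of_size n"
    by (auto simp: set_pmf_eq pmf split: if_splits)
  have "measure_pmf.prob ?M {T. P T} = measure_pmf.prob ?M {T. T \<in> trees_of_size n \<and> P T}"
    using set by (intro measure_prob_cong_0) (auto simp: set_pmf_iff)
  also have "\<dots> = (\<Sum>T | T \<in> trees_of_size n \<and> P T. pmf ?M T)"
    by (rule measure_measure_pmf_finite) (simp add: finite_trees_of_size)
  also have "\<dots> = (\<Sum>T | T \<in> trees_of_size n \<and> P T. weight w T) / partition_fun w n"
    unfolding sum_divide_distrib by (intro sum.cong) (auto simp: pmf partition_fun_def)
  finally show ?thesis .
qed

lemma num_protected_le: "num_protected T \<le> tree_size T"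
  by (simp add: num_protected_def tree_size_def)

lemma prop_protected_bounds: "0 \<le> prop_protected T" "prop_protected T \<le> 1"
  using num_protected_le[of T] tree_size_pos[of T] by (auto simp: prop_protected_def)

lemma isCont_gen_fun:
  assumes sums: "p sums 1" and "\<bar>t\<bar> < 1"
  shows "isCont (gen_fun p) t"
  unfolding gen_fun_def[abs_def]
  by (rule isCont_powser[where K=1]) (use assms sums_summable[OF sums] in auto)

text \<open>A Chernoff bound with small parameter \<open>\<theta> = \<sigma> * t\<close>, where
  \<open>\<sigma>\<close> selects the upper or lower tail. The bad trees weigh at most
  \<open>r t ^ n\<close> with \<open>r t < 1\<close>, which is negligible against the partition
  function by \<open>growth\<close>.\<close>

lemma protected_one_sided:
  assumes nonneg: "\<And>k. p k \<ge> 0" and sums: "p sums 1" and p0: "0 < p 0" "p 0 < 1"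
    and growth: "\<And>\<gamma>. 0 < \<gamma> \<Longrightarrow> \<gamma> < 1 \<Longrightarrow>
      \<exists>c>0. \<forall>n \<in> admissible p. partition_fun p n \<ge> c * \<gamma> ^ n"
    and \<epsilon>: "\<epsilon> > 0" and \<sigma>: "\<sigma> = 1 \<or> \<sigma> = -1"
  defines "q \<equiv> gen_fun p (1 - p 0) - p 0"
  shows "((\<lambda>n. measure_pmf.prob (simply_generated p n) {T. \<sigma> * (prop_protected T - q) > \<epsilon>})
    \<longlongrightarrow> 0) (inf sequentially (principal (admissible p)))"
proof -
  \<comment> \<open>The midpoint of \<open>q\<close> and \<open>c'\<close>: one half of
    \<open>\<epsilon>\<close> provides the slack for the supersolution inequality with
    \<open>\<eta> t\<close>, the other half makes \<open>r t < 1\<close>.\<close>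
  define c where "c = q + \<sigma> * \<epsilon> / 2"
  define c' where "c' = q + \<sigma> * \<epsilon>"
  define \<eta> where "\<eta> t = (exp (\<sigma> * t) - 1) * c" for t
  define v where "v t = 1 - p 0 / (1 + \<eta> t)" for t
  define r where "r t = (1 + \<eta> t) * exp (- (\<sigma> * t * c'))" for t
  have \<sigma>2: "\<sigma> * \<sigma> = 1" using \<sigma> by auto
  have \<eta>: "(\<eta> \<longlongrightarrow> 0) (at_right 0)"
    unfolding \<eta>_def by (auto intro!: tendsto_eq_intros)
  have v: "(v \<longlongrightarrow> 1 - p 0) (at_right 0)"
    unfolding v_def by (auto intro!: tendsto_eq_intros \<eta>)
  have h: "((\<lambda>t. \<sigma> * (gen_fun p (v t) - p 0 - c)) \<longlongrightarrow> \<sigma> * (q - c)) (at_right 0)"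
    unfolding q_def
    by (intro tendsto_intros isCont_tendsto_compose[OF isCont_gen_fun v] sums)
       (use p0 in auto)
  have "\<sigma> * (q - c) < 0" using \<epsilon> \<sigma> by (auto simp: c_def)
  then have ev_h: "\<forall>\<^sub>F t in at_right 0. \<sigma> * (gen_fun p (v t) - p 0 - c) < 0"
    by (rule order_tendstoD[OF h])
  have ev_\<eta>: "\<forall>\<^sub>F t in at_right 0. \<eta> t > p 0 - 1"
    using order_tendstoD(1)[OF \<eta>] p0 by simp
  \<comment> \<open>Since \<open>r 0 = 1\<close>, a negative derivative at 0 puts \<open>r t\<close>
    below 1 for small \<open>t > 0\<close>.\<close>
  have "(r has_real_derivative \<sigma> * (c - c')) (at 0)"
    unfolding r_def \<eta>_def by (auto intro!: derivative_eq_intros simp: algebra_simps)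
  moreover have "\<sigma> * (c - c') < 0" using \<epsilon> \<sigma> by (auto simp: c_def c'_def)
  ultimately obtain d where "d > 0" "\<And>h. h > 0 \<Longrightarrow> h < d \<Longrightarrow> r (0 + h) < r 0"
    using DERIV_neg_dec_right by blast
  then have ev_r: "\<forall>\<^sub>F t in at_right 0. r t < 1"
    unfolding eventually_at_right_field by (auto intro!: exI[of _ d] simp: r_def \<eta>_def)
  have "\<forall>\<^sub>F t in at_right 0. (t::real) > 0"
    by (rule eventually_at_right_less)
  with ev_h ev_\<eta> ev_r have "\<forall>\<^sub>F t in at_right 0.
      \<sigma> * (gen_fun p (v t) - p 0 - c) < 0 \<and> \<eta> t > p 0 - 1 \<and> r t < 1 \<and> t > 0"
    by eventually_elim auto
  then obtain t where t: "\<sigma> * (gen_fun p (v t) - p 0 - c) < 0" "\<eta> t > p 0 - 1" "r t < 1" "t > 0"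
    using eventually_happens'[OF trivial_limit_at_right_real] by blast
  define \<theta> where "\<theta> = \<sigma> * t"
  \<comment> \<open>The first factor has the sign of \<open>\<sigma>\<close>, the second the
    opposite one.\<close>
  have "(exp \<theta> - 1) * (gen_fun p (v t) - p 0 - c) \<le> 0"
  proof (cases "\<sigma> = 1")
    case True
    then show ?thesis using t by (intro mult_nonneg_nonpos) (auto simp: \<theta>_def)
  next
    case False
    then show ?thesis using t \<sigma> by (intro mult_nonpos_nonneg) (auto simp: \<theta>_def)
  qed
  then have ineq: "(exp \<theta> - 1) * (gen_fun p (v t) - p 0) \<le> \<eta> t"
    by (simp add: \<eta>_def \<theta>_def algebra_simps)
  have pos: "1 + \<eta> t > 0" "1 + \<eta> t \<ge> p 0" using t p0 by auto
  then have "r t > 0" by (simp add: r_def)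
  define \<gamma> where "\<gamma> = (1 + r t) / 2"
  have \<gamma>: "r t < \<gamma>" "\<gamma> > 0" "\<gamma> < 1" using t(3) \<open>r t > 0\<close> by (auto simp: \<gamma>_def)
  obtain C where C: "C > 0" "\<And>n. n \<in> admissible p \<Longrightarrow> partition_fun p n \<ge> C * \<gamma> ^ n"
    using growth[OF \<gamma>(2,3)] by blast
  have bound: "measure_pmf.prob (simply_generated p n) {T. \<sigma> * (prop_protected T - q) > \<epsilon>}
      \<le> (r t / \<gamma>) ^ n / C" if n: "n \<in> admissible p" for n
  proof -
    let ?bad = "\<lambda>T. \<sigma> * (prop_protected T - q) > \<epsilon>"
    \<comment> \<open>Markov's inequality, tree by tree: a bad tree has
      \<open>\<theta> * num_protected T > \<theta> * c' * n\<close>.\<close>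
    have "weight p T \<le> weight p T * exp (\<theta> * num_protected T) * exp (- (\<theta> * c')) ^ n"
      if T: "T \<in> trees_of_size n" "?bad T" for T
    proof -
      have n_pos: "n > 0" using T tree_size_pos[of T] by (auto simp: trees_of_size_def)
      have "\<sigma> * prop_protected T > \<sigma> * c'"
        using T(2) \<sigma> by (auto simp: c'_def)
      then have "\<sigma> * num_protected T > \<sigma> * c' * n"
        using T(1) n_pos by (simp add: prop_protected_def trees_of_size_def field_simps)
      then have "t * (\<sigma> * num_protected T) > t * (\<sigma> * c' * n)"
        using t by (intro mult_strict_left_mono)
      then have "1 \<le> exp (\<theta> * num_protected T - \<theta> * c' * n)"
        by (simp add: \<theta>_def algebra_simps)
      also have "\<dots> = exp (\<theta> * num_protected T) * exp (- (\<theta> * c')) ^ n"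
        by (simp add: exp_diff exp_minus exp_of_nat_mult[symmetric] field_simps)
      finally show ?thesis
        using mult_left_mono[of 1 "exp (\<theta> * num_protected T) * exp (- (\<theta> * c')) ^ n" "weight p T"]
          weight_nonneg[where w=p and T=T] nonneg by (simp add: mult.assoc)
    qed
    then have "(\<Sum>T | T \<in> trees_of_size n \<and> ?bad T. weight p T)
      \<le> (\<Sum>T | T \<in> trees_of_size n \<and> ?bad T.
          weight p T * exp (\<theta> * num_protected T) * exp (- (\<theta> * c')) ^ n)"
      by (intro sum_mono) auto
    also have "\<dots> \<le> (\<Sum>T \<in> trees_of_size n.
          weight p T * exp (\<theta> * num_protected T) * exp (- (\<theta> * c')) ^ n)"
      using weight_nonneg[where w=p] nonneg
      by (intro sum_mono2 finite_trees_of_size) auto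
    also have "\<dots> \<le> (1 + \<eta> t) ^ n * exp (- (\<theta> * c')) ^ n"
      unfolding sum_distrib_right[symmetric]
      by (intro mult_right_mono protected_exp_moment[where p=p, OF nonneg sums pos _ ineq])
         (auto simp: v_def)
    also have "\<dots> = r t ^ n" by (simp add: r_def \<theta>_def power_mult_distrib)
    finally have "(\<Sum>T | T \<in> trees_of_size n \<and> ?bad T. weight p T) / partition_fun p n
        \<le> r t ^ n / (C * \<gamma> ^ n)"
      using C(1) C(2)[OF n] \<gamma> \<open>r t > 0\<close> by (intro frac_le) auto
    then show ?thesis
      by (simp add: prob_simply_generated[where w=p, OF nonneg n] power_divide mult.commute)
  qed
  have "(\<lambda>n. (r t / \<gamma>) ^ n / C) \<longlonglongrightarrow> 0"
    using \<gamma> \<open>r t > 0\<close> by (intro tendsto_divide_zero LIMSEQ_realpow_zero) auto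
  then have "((\<lambda>n. (r t / \<gamma>) ^ n / C) \<longlongrightarrow> 0) (inf sequentially (principal (admissible p)))"
    by (rule tendsto_mono[rotated]) simp
  then show ?thesis
    by (rule tendsto_sandwich[OF _ _ tendsto_const, rotated 2])
       (auto simp: eventually_inf_principal bound)
qed

lemma protected_concentration:
  assumes nonneg: "\<And>k. p k \<ge> 0" and sums: "p sums 1" and p0: "0 < p 0" "p 0 < 1"
    and growth: "\<And>\<gamma>. 0 < \<gamma> \<Longrightarrow> \<gamma> < 1 \<Longrightarrow>
      \<exists>c>0. \<forall>n \<in> admissible p. partition_fun p n \<ge> c * \<gamma> ^ n"
    and \<epsilon>: "\<epsilon> > 0"
  defines "q \<equiv> gen_fun p (1 - p 0) - p 0"
  shows "((\<lambda>n. measure_pmf.prob (simply_generated p n) {T. \<bar>prop_protected T - q\<bar> > \<epsilon>})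
    \<longlongrightarrow> 0) (inf sequentially (principal (admissible p)))"
proof (rule tendsto_sandwich[OF _ _ tendsto_const])
  let ?P = "\<lambda>\<sigma> n. measure_pmf.prob (simply_generated p n) {T. \<sigma> * (prop_protected T - q) > \<epsilon>}"
  have "((\<lambda>n. ?P 1 n + ?P (-1) n) \<longlongrightarrow> 0 + 0) (inf sequentially (principal (admissible p)))"
    unfolding q_def
    by (intro tendsto_add protected_one_sided[where p=p, OF nonneg sums p0 growth \<epsilon>]) auto
  then show "((\<lambda>n. ?P 1 n + ?P (-1) n) \<longlongrightarrow> 0) (inf sequentially (principal (admissible p)))"
    by simp
  have "{T. \<bar>prop_protected T - q\<bar> > \<epsilon>}
      = {T. 1 * (prop_protected T - q) > \<epsilon>} \<union> {T. -1 * (prop_protected T - q) > \<epsilon>}"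
    by auto
  then show "\<forall>\<^sub>F n in inf sequentially (principal (admissible p)).
      measure_pmf.prob (simply_generated p n) {T. \<bar>prop_protected T - q\<bar> > \<epsilon>} \<le> ?P 1 n + ?P (-1) n"
    by (simp add: measure_Un_le)
qed auto

subsection \<open>Zero radius of convergence\<close>

text \<open>A node of outdegree \<open>d\<close> in \<open>{1..K}\<close> counts \<open>d\<close>
  times because contracting it removes the node itself and \<open>d - 1\<close> leaves.\<close>

definition small_edges :: "nat \<Rightarrow> ptree \<Rightarrow> nat" where
  "small_edges K T = (\<Sum>d\<leftarrow>code T. if d \<le> K then d else 0)"

lemma small_edges_Node:
  "small_edges K (Node ts) = (if length ts \<le> K then length ts else 0) + (\<Sum>t\<leftarrow>ts. small_edges K t)"
proof -
  have "(\<Sum>d\<leftarrow>concat (map code ts). if d \<le> K then d else 0) = (\<Sum>t\<leftarrow>ts. small_edges K t)"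
    by (induction ts) (auto simp: small_edges_def)
  then show ?thesis by (simp add: small_edges_def[of K "Node ts"] code_Node)
qed

text \<open>Protected nodes are internal. Those of outdegree at most \<open>K\<close> have at least
  one small edge each; the others have at least \<open>Suc K\<close> children each, and the
  outdegrees sum to less than the size.\<close>

lemma num_protected_le_small_edges:
  "Suc K * num_protected T \<le> Suc K * small_edges K T + tree_size T"
proof -
  have "length (filter is_protected vs) \<le> length (filter (\<lambda>v. outdegree v \<noteq> 0) vs)" for vs
    by (induction vs) (auto simp: is_protected_def is_leaf_def)
  then have "num_protected T \<le> length (filter (\<lambda>v. outdegree v \<noteq> 0) (nodes T))"
    by (simp add: num_protected_def)
  also have "\<dots> = length (filter (\<lambda>d. d \<noteq> 0) (code T))"
    by (simp add: code_def filter_map comp_def)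
  finally have "Suc K * num_protected T \<le> Suc K * length (filter (\<lambda>d. d \<noteq> 0) (code T))"
    by (rule mult_le_mono2)
  also have "Suc K * length (filter (\<lambda>d. d \<noteq> 0) ds)
      \<le> Suc K * (\<Sum>d\<leftarrow>ds. if d \<le> K then d else 0) + sum_list ds" for ds
  proof (induction ds)
    case (Cons d ds)
    have "Suc K * (if d = 0 then 0 else 1) \<le> Suc K * (if d \<le> K then d else 0) + d"
      by (cases d) auto
    with Cons show ?case by (auto simp: algebra_simps)
  qed simp
  finally show ?thesis using sum_list_code[of T] unfolding small_edges_def by linarith
qed

lemma ex_graft_list: "\<exists>V. code V = concat (map (\<lambda>U. butlast (code U)) Us) @ code U'"
proof (induction Us)
  case (Cons U Us)
  then obtain V where "code V = concat (map (\<lambda>U. butlast (code U)) Us) @ code U'" by blast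
  then show ?case using code_graft[of U V] by (intro exI[of _ "graft U V"]) simp
qed auto

text \<open>Delete all nodes with outdegree in \<open>{1..K}\<close>, always joining the subtrees of the children
  of a deleted node by planting each of them at the last leaf of the previous one. In \<open>c\<close> the
  degree sequence is annotated with \<open>False\<close> at the deleted nodes and leaves.\<close>

lemma ex_contraction:
  "\<exists>c U. map fst c = code T \<and> map fst (filter snd c) = code U \<and> snd (last c) \<and>
    (\<forall>(d, b) \<in> set c. \<not> b \<longrightarrow> d \<le> K) \<and> length (filter (\<lambda>x. \<not> snd x) c) = small_edges K T"
proof (induction T)
  case (Node ts)
  let ?Q = "\<lambda>t c U. map fst c = code t \<and> map fst (filter snd c) = code U \<and> snd (last c) \<and>
    (\<forall>(d, b) \<in> set c. \<not> b \<longrightarrow> d \<le> K) \<and> length (filter (\<lambda>x. \<not> snd x) c) = small_edges K t"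
  have "\<forall>t\<in>set ts. \<exists>x. ?Q t (fst x) (snd x)" using Node by fastforce
  then obtain X where X: "\<forall>t\<in>set ts. ?Q t (fst (X t)) (snd (X t))"
    by (rule bchoice[THEN exE])
  define c where "c t = fst (X t)" for t
  define U where "U t = snd (X t)" for t
  have Q: "?Q t (c t) (U t)" if "t \<in> set ts" for t
    using X that by (simp add: c_def U_def)
  have c_Nil: "c t \<noteq> []" if "t \<in> set ts" for t
    using Q[OF that] by (metis code_neq_Nil list.map_disc_iff)
  show ?case
  proof (cases ts rule: rev_cases)
    case Nil
    show ?thesis
      by (rule exI[of _ "[(0, True)]"], rule exI[of _ "Node []"])
         (simp add: Nil code_Node small_edges_Node)
  next
    case (snoc us u)
    show ?thesis
    proof (cases "length ts \<le> K")
      \<comment> \<open>A root of large outdegree is kept, and the subtrees of its children are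
        contracted separately.\<close>
      case False
      have *: "map fst (concat (map c vs)) = concat (map code vs) \<and>
          map fst (filter snd (concat (map c vs))) = concat (map code (map U vs)) \<and>
          (\<forall>(d, b) \<in> set (concat (map c vs)). \<not> b \<longrightarrow> d \<le> K) \<and>
          length (filter (\<lambda>x. \<not> snd x) (concat (map c vs))) = (\<Sum>t\<leftarrow>vs. small_edges K t)"
        if "set vs \<subseteq> set ts" for vs
        using that
      proof (induction vs)
        case (Cons v vs)
        then show ?case using Q[of v] by auto
      qed simp
      have "snd (last (concat (map c ts)))"
        using Q[of u] c_Nil[of u] by (simp add: snoc)
      then show ?thesis
        using *[of ts] False c_Nil[of u]
        by (intro exI[of _ "(length ts, True) # concat (map c ts)"] exI[of _ "Node (map U ts)"])
           (auto simp: code_Node small_edges_Node snoc)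
    next
      case True
      \<comment> \<open>The last leaf of each subtree in \<open>us\<close> gives way to the next
        subtree, so its mark changes from \<open>True\<close> to \<open>False\<close>. The invariant
        \<open>snd (last c)\<close> ensures that this leaf was still present.\<close>
      define c' where "c' t = butlast (c t) @ [(0, False)]" for t
      have c': "map fst (c' t) = code t" "map fst (filter snd (c' t)) = butlast (code (U t))"
        "\<forall>(d, b) \<in> set (c' t). \<not> b \<longrightarrow> d \<le> K"
        "length (filter (\<lambda>x. \<not> snd x) (c' t)) = Suc (small_edges K t)" if "t \<in> set ts" for t
      proof -
        note Q = Q[OF that]
        have "fst (last (c t)) = 0"
          using Q last_code[of t] c_Nil[OF that] by (metis last_map)
        then have "last (c t) = (0, True)" using Q by (simp add: prod_eq_iff)
        then have eq: "c t = butlast (c t) @ [(0, True)]"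
          using append_butlast_last_id[OF c_Nil[OF that]] by simp
        have "map fst (butlast (c t)) @ [0] = code t" using Q by (subst (asm) (1) eq) simp
        then show "map fst (c' t) = code t" by (simp add: c'_def)
        have "map fst (filter snd (butlast (c t))) @ [0] = code (U t)"
          using Q by (subst (asm) (2) eq) simp
        then have "butlast (map fst (filter snd (butlast (c t))) @ [0]) = butlast (code (U t))"
          by (rule arg_cong)
        then show "map fst (filter snd (c' t)) = butlast (code (U t))" by (simp add: c'_def)
        show "\<forall>(d, b) \<in> set (c' t). \<not> b \<longrightarrow> d \<le> K"
          using Q by (auto simp: c'_def dest: in_set_butlastD)
        have "length (filter (\<lambda>x. \<not> snd x) (butlast (c t) @ [(0, True)])) = small_edges K t"
          using Q unfolding eq[symmetric] by blast
        then show "length (filter (\<lambda>x. \<not> snd x) (c' t)) = Suc (small_edges K t)"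
          by (simp add: c'_def)
      qed
      have *: "map fst (concat (map c' vs)) = concat (map code vs) \<and>
          map fst (filter snd (concat (map c' vs)))
            = concat (map (\<lambda>U. butlast (code U)) (map U vs)) \<and>
          (\<forall>(d, b) \<in> set (concat (map c' vs)). \<not> b \<longrightarrow> d \<le> K) \<and>
          length (filter (\<lambda>x. \<not> snd x) (concat (map c' vs)))
            = length vs + (\<Sum>t\<leftarrow>vs. small_edges K t)"
        if "set vs \<subseteq> set ts" for vs
        using that
      proof (induction vs)
        case (Cons v vs)
        then show ?case using c'[of v] by auto
      qed simp
      obtain V where V: "code V = concat (map (\<lambda>U. butlast (code U)) (map U us)) @ code (U u)"
        using ex_graft_list by blast
      have us: "set us \<subseteq> set ts" and u: "u \<in> set ts" by (auto simp: snoc)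
      show ?thesis
        using *[OF us] Q[OF u] c_Nil[OF u] True V
        by (intro exI[of _ "(length ts, False) # concat (map c' us) @ c u"] exI[of _ V])
           (auto simp: code_Node small_edges_Node snoc)
    qed
  qed
qed

text \<open>The first list shows which entries are deleted and their degrees; the kept degrees are
  then filled in, in order, from the second.\<close>

lemma annotated_list_inject:
  "map (\<lambda>(d, b). if b then 0 else Suc d) c = map (\<lambda>(d, b). if b then 0 else Suc d) c' \<Longrightarrow>
   map fst (filter snd c) = map fst (filter snd c') \<Longrightarrow> c = c'"
proof (induction c arbitrary: c')
  case (Cons x c)
  then obtain x' c'' where "c' = x' # c''" by (cases c') auto
  with Cons show ?case by (cases x; cases x') (auto split: if_splits)
qed simp

text \<open>Each \<open>d\<close> is realised by a star with \<open>d\<close> leaves, and shifted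
  sizes add. This makes the growth bound applicable at size \<open>Suc s\<close>, with
  \<open>s\<close> the number of small edges.\<close>

lemma admissible_small_edges:
  assumes "\<And>k. w k \<ge> 0" and "w 0 > 0" and "\<forall>d\<in>set ds. w d > 0"
  shows "Suc (\<Sum>d\<leftarrow>ds. if d \<le> K then d else 0) \<in> admissible w"
  using assms(3)
proof (induction ds)
  case Nil
  then show ?case using admissible_star[where w=w and d=0] assms(2) by simp
next
  case (Cons d ds)
  have "Suc (if d \<le> K then d else 0) \<in> admissible w"
    using Cons admissible_star[where w=w] assms(2) by auto
  then show ?case using admissible_add[where w=w, OF assms(1)] Cons by simp
qed

text \<open>A tree is recovered from its contraction, which has \<open>n - s\<close> nodes, and a
  word of length \<open>n\<close> over \<open>K + 2\<close> letters recording the deletions. Each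
  deleted entry costs a weight factor of at most \<open>M\<close>.\<close>

lemma weight_many_small_edges:
  assumes nonneg: "\<And>k. w k \<ge> 0" and w0: "w 0 > 0" and M: "M \<ge> 1" "\<And>d. d \<le> K \<Longrightarrow> w d \<le> M"
  shows "(\<Sum>T | T \<in> trees_of_size n \<and> small_edges K T \<ge> h. weight w T)
    \<le> (M * real (K + 2)) ^ n *
      (\<Sum>s | h \<le> s \<and> s < n \<and> Suc s \<in> admissible w. partition_fun w (n - s))"
proof -
  obtain c U where c: "\<And>T. map fst (c T) = code T" "\<And>T. map fst (filter snd (c T)) = code (U T)"
    "\<And>T. \<forall>(d, b) \<in> set (c T). \<not> b \<longrightarrow> d \<le> K"
    "\<And>T. length (filter (\<lambda>x. \<not> snd x) (c T)) = small_edges K T"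
    using ex_contraction[of _ K] by metis
  \<comment> \<open>0 marks a kept entry and \<open>Suc d\<close> a deleted one of degree
    \<open>d \<le> K\<close>, so the letters lie in \<open>{..K + 1}\<close>.\<close>
  define mark where "mark = (\<lambda>(d, b). if b then 0 else Suc d)"
  define m where "m T = map mark (c T)" for T
  define S where "S = {s. h \<le> s \<and> s < n \<and> Suc s \<in> admissible w}"
  \<comment> \<open>Positive weight makes \<open>w\<close> positive at every outdegree of
    \<open>T\<close>, as the admissibility of \<open>Suc s\<close> requires.\<close>
  define B where "B = {T. T \<in> trees_of_size n \<and> small_edges K T \<ge> h \<and> weight w T > 0}"
  define V where "V = (\<Union>s\<in>S. trees_of_size (n - s))"
  define L where "L = {xs. set xs \<subseteq> {..K + 1} \<and> length xs = n}"
  have w_nn: "weight w T \<ge> 0" for T using weight_nonneg[where w=w] nonneg by blast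
  have fin: "finite V" "finite L" "finite S"
    unfolding V_def L_def S_def by (auto simp: finite_trees_of_size intro: finite_lists_length_eq)
  have len: "length (c T) = tree_size T" for T
    using arg_cong[OF c(1)[of T], of length] by (simp add: length_code)
  have size_U: "tree_size (U T) + small_edges K T = tree_size T" for T
    using arg_cong[OF c(2)[of T], of length] sum_length_filter_compl[of snd "c T"] c(4)[of T] len[of T]
    by (simp add: length_code)
  have inj: "inj_on (\<lambda>T. (U T, m T)) B"
  proof (rule inj_onI)
    fix T T' assume "(U T, m T) = (U T', m T')"
    then have "c T = c T'"
      using annotated_list_inject[of "c T" "c T'"] c(2) by (simp add: m_def mark_def)
    then show "T = T'" using c(1) injD[OF inj_code] by metis
  qed
  have sub: "(\<lambda>T. (U T, m T)) ` B \<subseteq> V \<times> L"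
  proof clarify
    fix T assume T: "T \<in> B"
    have "w d > 0" if d: "d \<in> set (code T)" for d
    proof (rule ccontr)
      assume "\<not> w d > 0"
      then have "w d = 0" using nonneg[of d] by linarith
      then have "weight w T = 0" using d by (force simp: weight_code prod_list_zero_iff)
      then show False using T by (simp add: B_def)
    qed
    then have "Suc (small_edges K T) \<in> admissible w"
      unfolding small_edges_def by (intro admissible_small_edges nonneg w0) auto
    then have "small_edges K T \<in> S"
      using T size_U[of T] tree_size_pos[of "U T"] by (auto simp: S_def B_def trees_of_size_def)
    moreover have "U T \<in> trees_of_size (n - small_edges K T)"
      using T size_U[of T] by (auto simp: B_def trees_of_size_def)
    ultimately have "U T \<in> V" by (auto simp: V_def)
    moreover have "m T \<in> L"
      using T c(3)[of T] len[of T] by (auto simp: L_def m_def mark_def B_def trees_of_size_def)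
    ultimately show "U T \<in> V \<and> m T \<in> L" by blast
  qed
  have weight_le: "weight w T \<le> M ^ n * weight w (U T)" if "T \<in> B" for T
  proof -
    have "(\<Prod>x\<leftarrow>xs. w (fst x)) \<le> M ^ length xs * (\<Prod>x\<leftarrow>filter snd xs. w (fst x))"
      if "\<forall>(d, b) \<in> set xs. \<not> b \<longrightarrow> d \<le> K" for xs :: "(nat \<times> bool) list"
      using that
    proof (induction xs)
      case (Cons x xs)
      let ?P = "\<Prod>x\<leftarrow>filter snd xs. w (fst x)"
      have P: "?P \<ge> 0" using nonneg by (intro prod_list_nonneg) auto
      have IH: "(\<Prod>x\<leftarrow>xs. w (fst x)) \<le> M ^ length xs * ?P" using Cons by auto
      have "w (fst x) * (\<Prod>x\<leftarrow>xs. w (fst x)) \<le> w (fst x) * (M ^ length xs * ?P)"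
        using IH nonneg by (rule mult_left_mono)
      also have "\<dots> \<le> M ^ length (x # xs) * (\<Prod>x\<leftarrow>filter snd (x # xs). w (fst x))"
      proof (cases "snd x")
        case True
        have "1 * (w (fst x) * (M ^ length xs * ?P)) \<le> M * (w (fst x) * (M ^ length xs * ?P))"
          using M(1) P nonneg by (intro mult_right_mono) auto
        then show ?thesis using True by (simp add: mult_ac)
      next
        case False
        then have "w (fst x) \<le> M" using Cons.prems M(2) by (cases x) auto
        then have "w (fst x) * (M ^ length xs * ?P) \<le> M * (M ^ length xs * ?P)"
          using M(1) P by (intro mult_right_mono) auto
        then show ?thesis using False by (simp add: mult_ac)
      qed
      finally show ?case by simp
    qed simp
    from this[of "c T"] show ?thesis
      using c(1,2)[of T, symmetric] c(3)[of T] len[of T] that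
      by (simp add: weight_code comp_def B_def trees_of_size_def)
  qed
  have "(\<Sum>T | T \<in> trees_of_size n \<and> small_edges K T \<ge> h. weight w T) = (\<Sum>T\<in>B. weight w T)"
    using w_nn finite_trees_of_size[of n]
    by (intro sum.mono_neutral_right) (auto simp: B_def less_le)
  also have "\<dots> \<le> (\<Sum>T\<in>B. M ^ n * weight w (U T))"
    by (intro sum_mono weight_le)
  also have "\<dots> = (\<Sum>(U, m) \<in> (\<lambda>T. (U T, m T)) ` B. M ^ n * weight w U)"
    by (subst sum.reindex[OF inj]) simp
  also have "\<dots> \<le> (\<Sum>(U, m) \<in> V \<times> L. M ^ n * weight w U)"
    using sub fin w_nn M(1) by (intro sum_mono2) auto
  also have "\<dots> = (M * real (K + 2)) ^ n * (\<Sum>U\<in>V. weight w U)"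
    using card_lists_length_eq[of "{..K + 1}" n]
    by (simp add: sum.cartesian_product[symmetric] L_def sum_distrib_left sum_distrib_right
        power_mult_distrib mult_ac)
  also have "(\<Sum>U\<in>V. weight w U) = (\<Sum>s\<in>S. partition_fun w (n - s))"
    unfolding V_def partition_fun_def
    by (rule sum.UNION_disjoint) (auto simp: fin finite_trees_of_size, auto simp: S_def trees_of_size_def)
  finally show ?thesis by (simp add: S_def)
qed

text \<open>Many protected nodes force \<open>s\<close> small edges with \<open>s\<close> at least
  \<open>n / Suc K\<close>. Contraction costs \<open>A ^ n\<close>, but supermultiplicativity bounds
  the partition function at \<open>n - s\<close> by \<open>w 0\<close> times its ratio at
  \<open>n\<close> and \<open>Suc s\<close>, and the superexponential growth at \<open>Suc s\<close>
  wins.\<close>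

lemma protected_negligible:
  assumes nonneg: "\<And>k. w k \<ge> 0" and w0: "w 0 > 0" and radius: "conv_radius w = 0"
    and \<epsilon>: "\<epsilon> > 0"
  shows "((\<lambda>n. measure_pmf.prob (simply_generated w n) {T. prop_protected T > \<epsilon>})
    \<longlongrightarrow> 0) (inf sequentially (principal (admissible w)))"
proof -
  \<comment> \<open>Then \<open>Suc K * \<epsilon> \<ge> 2\<close>: of the resulting
    \<open>2 * n\<close>, the nodes of outdegree above \<open>K\<close> account for at most
    \<open>n\<close>.\<close>
  obtain K :: nat where K: "2 / \<epsilon> < real K" using reals_Archimedean2 by blast
  define M where "M = Max (insert 1 (w ` {..K}))"
  have M: "w d \<le> M" if "d \<le> K" for d
    unfolding M_def using that by (intro Max_ge) auto
  have M1: "M \<ge> 1" by (simp add: M_def)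
  define A where "A = M * real (K + 2)"
  have A: "A \<ge> 1" unfolding A_def using M1 mult_mono[of 1 M 1 "real (K + 2)"] by simp
  \<comment> \<open>As \<open>n \<le> Suc K * Suc s\<close>, this base yields at least
    \<open>(4 * A) ^ n\<close> at size \<open>Suc s\<close>: \<open>A ^ n\<close> cancels the cost
    of contraction, and \<open>4 ^ n\<close> absorbs the at most \<open>n\<close> values of
    \<open>s\<close>.\<close>
  obtain C where C: "C > 0"
    "\<And>n. n \<in> admissible w \<Longrightarrow> partition_fun w n \<ge> C * ((4 * A) ^ Suc K) ^ n"
    using partition_fun_growth_radius_0[where w=w and \<gamma>="(4 * A) ^ Suc K", OF nonneg w0 radius] A
    by auto
  have bound: "measure_pmf.prob (simply_generated w n) {T. prop_protected T > \<epsilon>}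
      \<le> w 0 / C * (1 / 2) ^ n" if n: "n \<in> admissible w" for n
  proof -
    let ?Z = "partition_fun w n"
    have Z: "?Z > 0" using n nonneg partition_fun_pos_iff by blast
    define h where "h = (LEAST h. n \<le> Suc K * h)"
    have "n \<le> Suc K * n" by simp
    then have h: "n \<le> Suc K * h" unfolding h_def by (rule LeastI)
    have small: "small_edges K T \<ge> h" if T: "T \<in> trees_of_size n" "prop_protected T > \<epsilon>" for T
    proof -
      have n_pos: "n > 0" using T tree_size_pos[of T] by (auto simp: trees_of_size_def)
      have "real (num_protected T) > \<epsilon> * n"
        using T n_pos by (simp add: prop_protected_def trees_of_size_def field_simps)
      then have "real (Suc K) * num_protected T \<ge> real (Suc K) * (\<epsilon> * n)"
        by (intro mult_left_mono) auto
      moreover have "(real (Suc K) * \<epsilon>) * real n \<ge> 2 * real n"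
        using K \<epsilon> by (intro mult_right_mono) (auto simp: field_simps)
      ultimately have "real (Suc K * num_protected T) \<ge> real (2 * n)"
        unfolding of_nat_mult of_nat_numeral mult.assoc by linarith
      then have "Suc K * num_protected T \<ge> 2 * n" by (simp only: of_nat_le_iff)
      then have "n \<le> Suc K * small_edges K T"
        using num_protected_le_small_edges[of K T] T(1) by (simp add: trees_of_size_def)
      then show ?thesis unfolding h_def by (rule Least_le)
    qed
    have Z_le: "partition_fun w (n - s) \<le> w 0 / (C * (4 * A) ^ n) * ?Z"
      if s: "h \<le> s" "s < n" "Suc s \<in> admissible w" for s
    proof -
      have "n \<le> Suc K * s" using h s(1) by (meson le_trans mult_le_mono2)
      then have "n \<le> Suc K * Suc s" by simp
      then have "C * (4 * A) ^ n \<le> C * ((4 * A) ^ Suc K) ^ Suc s"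
        unfolding power_mult[symmetric] using A C(1) by (intro mult_left_mono power_increasing) auto
      also have "\<dots> \<le> partition_fun w (Suc s)" by (rule C(2)[OF s(3)])
      finally have "partition_fun w (n - s) * (C * (4 * A) ^ n)
          \<le> partition_fun w (n - s) * partition_fun w (Suc s)"
        using partition_fun_nonneg[where w=w] nonneg by (intro mult_left_mono) auto
      also have "\<dots> \<le> w 0 * ?Z"
        using partition_fun_supermult[where w=w and a="n - Suc s" and b=s, OF nonneg] s(2)
        by (simp add: Suc_diff_Suc)
      finally show ?thesis using A C(1) by (simp add: field_simps)
    qed
    have "(\<Sum>T | T \<in> trees_of_size n \<and> prop_protected T > \<epsilon>. weight w T)
        \<le> (\<Sum>T | T \<in> trees_of_size n \<and> small_edges K T \<ge> h. weight w T)"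
      using small finite_trees_of_size[of n] weight_nonneg[where w=w] nonneg
      by (intro sum_mono2) auto
    also have "\<dots> \<le> A ^ n *
        (\<Sum>s | h \<le> s \<and> s < n \<and> Suc s \<in> admissible w. partition_fun w (n - s))"
      unfolding A_def using M M1 by (intro weight_many_small_edges nonneg w0) auto
    also have "\<dots> \<le> A ^ n * (\<Sum>s | h \<le> s \<and> s < n \<and> Suc s \<in> admissible w.
        w 0 / (C * (4 * A) ^ n) * ?Z)"
      using A Z_le by (intro mult_left_mono sum_mono) auto
    also have "\<dots> \<le> A ^ n * (\<Sum>s\<in>{..<n}. w 0 / (C * (4 * A) ^ n) * ?Z)"
      using A C(1) Z w0 by (intro mult_left_mono sum_mono2) auto
    also have "\<dots> = real n / 4 ^ n * (w 0 / C) * ?Z"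
      using A by (simp add: power_mult_distrib mult_ac)
    also have "\<dots> \<le> (1 / 2) ^ n * (w 0 / C) * ?Z"
    proof (intro mult_right_mono)
      have "real n \<le> 2 ^ n" using of_nat_less_two_power[of n, where 'a=real] by simp
      moreover have "(4::real) ^ n = 2 ^ n * 2 ^ n" by (simp add: power_mult_distrib[symmetric])
      ultimately show "real n / 4 ^ n \<le> (1 / 2) ^ n"
        by (simp add: power_one_over field_simps)
    qed (use Z w0 C(1) in auto)
    finally show ?thesis
      using Z by (simp add: prob_simply_generated[where w=w, OF nonneg n] field_simps)
  qed
  have "(\<lambda>n. w 0 / C * (1 / 2) ^ n) \<longlonglongrightarrow> 0"
    by (intro tendsto_mult_right_zero LIMSEQ_realpow_zero) auto
  then have lim: "((\<lambda>n. w 0 / C * (1 / 2) ^ n) \<longlongrightarrow> 0) (inf sequentially (principal (admissible w)))"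
    by (rule tendsto_mono[rotated]) simp
  have "\<forall>\<^sub>F n in inf sequentially (principal (admissible w)).
      measure_pmf.prob (simply_generated w n) {T. prop_protected T > \<epsilon>} \<le> w 0 / C * (1 / 2) ^ n"
    unfolding eventually_inf_principal using bound by (intro always_eventually) blast
  then show ?thesis
    by (rule tendsto_sandwich[OF _ _ tendsto_const lim, rotated]) simp
qed

subsection \<open>Tilting\<close>

text \<open>The outdegrees sum to \<open>n - 1\<close>, so tilting multiplies all trees with
  \<open>n\<close> nodes by the same constant.\<close>

lemma tilted_weight:
  assumes "gen_fun w \<tau> \<noteq> 0" and "T \<in> trees_of_size n"
  shows "weight (tilted w \<tau>) T = weight w T * (\<tau> ^ (n - 1) / gen_fun w \<tau> ^ n)"
proof -
  have "(\<Prod>d\<leftarrow>ds. tilted w \<tau> d) = (\<Prod>d\<leftarrow>ds. w d) * (\<tau> ^ sum_list ds / gen_fun w \<tau> ^ length ds)" for ds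
    by (induction ds) (auto simp: tilted_def power_add field_simps)
  moreover have "sum_list (code T) = n - 1" "length (code T) = n"
    using sum_list_code[of T] assms(2) by (auto simp: trees_of_size_def length_code)
  ultimately show ?thesis by (simp add: weight_code)
qed

lemma simply_generated_tilted:
  assumes "gen_fun w \<tau> > 0" and "\<tau> > 0"
  shows "simply_generated (tilted w \<tau>) n = simply_generated w n"
    and "admissible (tilted w \<tau>) = admissible w"
proof -
  define a where "a n = \<tau> ^ (n - 1) / gen_fun w \<tau> ^ n" for n
  have a: "a n > 0" for n using assms by (simp add: a_def)
  have tw: "weight (tilted w \<tau>) T = weight w T * a n" if "T \<in> trees_of_size n" for T n
    using tilted_weight that assms(1) by (auto simp: a_def)
  have "(\<Sum>T\<in>trees_of_size n. weight (tilted w \<tau>) T) = (\<Sum>T\<in>trees_of_size n. weight w T) * a n"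
    unfolding sum_distrib_right by (intro sum.cong) (auto simp: tw)
  then have "(if T \<in> trees_of_size n then weight (tilted w \<tau>) T /
        (\<Sum>T'\<in>trees_of_size n. weight (tilted w \<tau>) T') else 0)
      = (if T \<in> trees_of_size n then weight w T / (\<Sum>T'\<in>trees_of_size n. weight w T') else 0)" for T
    using a[of n] by (simp add: tw)
  then show "simply_generated (tilted w \<tau>) n = simply_generated w n"
    unfolding simply_generated_def by simp
  show "admissible (tilted w \<tau>) = admissible w"
    unfolding admissible_def using a by (auto simp: tw zero_less_mult_iff dest: less_asym)
qed

section \<open>From concentration to the annealed limit\<close>

lemma pmf_random_node_protected:
  "pmf (random_node_protected w n) True
    = measure_pmf.expectation (simply_generated w n) prop_protected"
proof -
  have "pmf (map_pmf (\<lambda>i. is_protected (nodes T ! i)) (pmf_of_set {..<tree_size T})) True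
      = prop_protected T" for T
  proof -
    have ne: "{..<tree_size T} \<noteq> {}" using tree_size_pos[of T] by auto
    have "{..<tree_size T} \<inter> (\<lambda>i. is_protected (nodes T ! i)) -` {True}
        = {i. i < length (nodes T) \<and> is_protected (nodes T ! i)}"
      by (auto simp: tree_size_def)
    then show ?thesis
      using measure_pmf_of_set[OF ne] 
      by (simp add: pmf_map prop_protected_def num_protected_def length_filter_conv_card)
  qed
  then show ?thesis unfolding random_node_protected_def pmf_bind by simp
qed

text \<open>The deviation is at most \<open>e / 2\<close> off the exceptional event and at most 1 on
  it.\<close>

lemma expectation_tendsto_of_tendsto_in_prob:
  fixes M :: "'b \<Rightarrow> 'a pmf" and X :: "'a \<Rightarrow> real"
  assumes X: "\<And>x. \<bar>X x - q\<bar> \<le> 1"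
    and prob: "\<And>\<epsilon>. \<epsilon> > 0 \<Longrightarrow> ((\<lambda>n. measure_pmf.prob (M n) {x. \<bar>X x - q\<bar> > \<epsilon>}) \<longlongrightarrow> 0) F"
  shows "((\<lambda>n. measure_pmf.expectation (M n) X) \<longlongrightarrow> q) F"
proof (rule tendstoI)
  fix e :: real assume e: "e > 0"
  define A where "A = {x. \<bar>X x - q\<bar> > e / 2}"
  have bound: "\<bar>measure_pmf.expectation (M n) X - q\<bar> \<le> e / 2 + measure_pmf.prob (M n) A" for n
  proof -
    have int_diff: "integrable (M n) (\<lambda>x. X x - q)"
      by (rule measure_pmf.integrable_const_bound[where B=1]) (use X in auto)
    then have "integrable (M n) (\<lambda>x. (X x - q) + q)" by (intro Bochner_Integration.integrable_add) auto
    then have int: "integrable (M n) X" by simp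
    have "measure_pmf.expectation (M n) X - q = measure_pmf.expectation (M n) (\<lambda>x. X x - q)"
      using int by simp
    also have "\<bar>\<dots>\<bar> \<le> measure_pmf.expectation (M n) (\<lambda>x. \<bar>X x - q\<bar>)"
      by (rule integral_abs_bound)
    also have "\<dots> \<le> measure_pmf.expectation (M n) (\<lambda>x. e / 2 + indicator A x)"
    proof (rule integral_mono)
      show "integrable (M n) (\<lambda>x. \<bar>X x - q\<bar>)" using int_diff by (rule integrable_abs)
      show "integrable (M n) (\<lambda>x. e / 2 + indicator A x :: real)"
        by (rule measure_pmf.integrable_const_bound[where B="e / 2 + 1"])
           (use e in \<open>auto simp: indicator_def\<close>)
      show "\<bar>X x - q\<bar> \<le> e / 2 + indicator A x" for x
        using X[of x] e by (auto simp: A_def indicator_def)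
    qed
    also have "\<dots> = e / 2 + measure_pmf.prob (M n) A"
      by (subst Bochner_Integration.integral_add)
         (auto intro: measure_pmf.integrable_const_bound[where B=1])
    finally show ?thesis .
  qed
  have "((\<lambda>n. measure_pmf.prob (M n) A) \<longlongrightarrow> 0) F"
    unfolding A_def using e by (intro prob) simp
  then have "\<forall>\<^sub>F n in F. measure_pmf.prob (M n) A < e / 2"
    using e by (intro order_tendstoD) auto
  then show "\<forall>\<^sub>F n in F. dist (measure_pmf.expectation (M n) X) q < e"
  proof eventually_elim
    case (elim n)
    then show ?case using bound[of n] unfolding dist_real_def by linarith
  qed
qed

section \<open>The tilted distribution: formula for the limit, mean and mass at 0\<close>

lemma is_tau_nonneg: "is_tau w \<tau> \<Longrightarrow> \<tau> \<ge> 0"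
  using conv_radius_nonneg[of w]
  by (auto simp: is_tau_def tau_equation_def split: if_splits) (metis ereal_less_eq(5))

lemma gen_fun_0: "gen_fun w 0 = w 0"
  using powser_zero[of w] by (simp add: gen_fun_def)

lemma tilted_nonneg:
  "(\<And>k. w k \<ge> 0) \<Longrightarrow> \<tau> \<ge> 0 \<Longrightarrow> summable (\<lambda>k. w k * \<tau> ^ k) \<Longrightarrow> tilted w \<tau> k \<ge> 0"
  by (auto simp: tilted_def gen_fun_def intro!: divide_nonneg_nonneg suminf_nonneg)

lemma tilted_sums:
  assumes "summable (\<lambda>k. w k * \<tau> ^ k)" "gen_fun w \<tau> \<noteq> 0"
  shows "tilted w \<tau> sums 1"
  using sums_divide[OF summable_sums[OF assms(1)], of "gen_fun w \<tau>"] assms(2)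
  by (simp add: tilted_def[abs_def] gen_fun_def)

lemma tilted_0_le_1:
  assumes nonneg: "\<And>k. w k \<ge> 0" and \<tau>: "\<tau> \<ge> 0" and sm: "summable (\<lambda>k. w k * \<tau> ^ k)"
  shows "tilted w \<tau> 0 \<le> 1"
proof (cases "gen_fun w \<tau> = 0")
  case False
  note sums = tilted_sums[OF sm False]
  show ?thesis
    using sum_le_suminf[OF sums_summable[OF sums], of "{0}"] sums_unique[OF sums]
      tilted_nonneg[where w=w, OF nonneg \<tau> sm] by simp
qed (simp add: tilted_def)

lemma p_star_eq:
  assumes nonneg: "\<And>k. w k \<ge> 0" and \<tau>: "\<tau> \<ge> 0" and sm: "summable (\<lambda>k. w k * \<tau> ^ k)"
  shows "p_star w \<tau> = (gen_fun w (\<tau> - \<tau> * w 0 / gen_fun w \<tau>) - w 0) / gen_fun w \<tau>"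
proof (cases "gen_fun w \<tau> = 0")
  \<comment> \<open>Division by 0 yields 0, so \<open>tilted w \<tau>\<close> and both sides
    vanish.\<close>
  case True
  then show ?thesis by (simp add: p_star_def tilted_def gen_fun_def)
next
  case False
  define s where "s = 1 - tilted w \<tau> 0"
  have s: "0 \<le> s" "s \<le> 1"
    using tilted_0_le_1[where w=w, OF nonneg \<tau> sm] tilted_nonneg[where w=w, OF nonneg \<tau> sm]
    by (auto simp: s_def)
  have "summable (\<lambda>k. w k * (\<tau> * s) ^ k)"
  proof (rule summable_comparison_test'[OF sm])
    show "norm (w k * (\<tau> * s) ^ k) \<le> w k * \<tau> ^ k" for k
      using nonneg[of k] \<tau> s
      by (simp add: power_mult_distrib mult_left_le power_le_one mult_left_mono)
  qed
  then have "(\<Sum>k. w k * (\<tau> * s) ^ k / gen_fun w \<tau>) = gen_fun w (\<tau> * s) / gen_fun w \<tau>"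
    unfolding gen_fun_def[of w "\<tau> * s"] by (rule suminf_divide)
  then have "gen_fun (tilted w \<tau>) s = gen_fun w (\<tau> * s) / gen_fun w \<tau>"
    by (simp add: gen_fun_def[of "tilted w \<tau>"] tilted_def power_mult_distrib mult_ac)
  moreover have "\<tau> * s = \<tau> - \<tau> * w 0 / gen_fun w \<tau>"
    by (simp add: s_def tilted_def algebra_simps)
  ultimately show ?thesis
    by (simp add: p_star_def s_def[symmetric]) (simp add: tilted_def diff_divide_distrib)
qed

lemma abs_prop_protected_diff_p_star_le:
  assumes nonneg: "\<And>k. w k \<ge> 0" and \<tau>: "\<tau> \<ge> 0" and sm: "summable (\<lambda>k. w k * \<tau> ^ k)"
  shows "\<bar>prop_protected T - p_star w \<tau>\<bar> \<le> 1"
proof (cases "gen_fun w \<tau> = 0")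
  case True
  then show ?thesis
    using prop_protected_bounds[of T] by (simp add: p_star_def tilted_def gen_fun_def)
next
  case False
  note sums = tilted_sums[OF sm False]
  note nn = tilted_nonneg[where w=w, OF nonneg \<tau> sm]
  define s where "s = 1 - tilted w \<tau> 0"
  have s: "0 \<le> s" "s \<le> 1"
    using tilted_0_le_1[where w=w, OF nonneg \<tau> sm] nn by (auto simp: s_def)
  have le: "tilted w \<tau> k * s ^ k \<le> tilted w \<tau> k" for k
    using nn[of k] s by (simp add: mult_left_le power_le_one)
  have sm_s: "summable (\<lambda>k. tilted w \<tau> k * s ^ k)"
    by (rule summable_comparison_test'[OF sums_summable[OF sums]]) (use le nn s in auto)
  have "gen_fun (tilted w \<tau>) s \<le> 1"
    unfolding gen_fun_def using sums_le[OF le summable_sums[OF sm_s] sums] .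
  moreover have "tilted w \<tau> 0 \<le> gen_fun (tilted w \<tau>) s"
    unfolding gen_fun_def using sum_le_suminf[OF sm_s, of "{0}"] nn s by simp
  ultimately have "0 \<le> p_star w \<tau>" "p_star w \<tau> \<le> 1"
    using nn[of 0] by (auto simp: p_star_def s_def[symmetric])
  then show ?thesis using prop_protected_bounds[of T] by (simp add: abs_le_iff)
qed

text \<open>If no \<open>t\<close> solves \<open>tau_equation w\<close>, then \<open>\<Phi>(t) - t \<Phi>'(t)\<close> has no zero below the radius of
  convergence, hence it keeps its sign.\<close>

lemma mean_le_of_no_tau_equation:
  assumes w0: "w 0 > 0" and none: "\<nexists>t. tau_equation w t"
    and t: "0 < t" "ereal t < conv_radius w"
  shows "summable (\<lambda>k. diffs w k * t ^ k) \<and> t * gen_fun (diffs w) t \<le> gen_fun w t"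
proof -
  have rad: "ereal (norm s) < conv_radius w" if "0 \<le> s" "s \<le> t" for s
    using that t by (auto intro: le_less_trans[of _ "ereal t"])
  have sm_w: "summable (\<lambda>k. w k * s ^ k)" if "ereal (norm s) < conv_radius w" for s
    using that by (rule summable_in_conv_radius)
  have sm_diffs: "summable (\<lambda>k. diffs w k * s ^ k)" if s: "ereal (norm s) < conv_radius w" for s
  proof -
    obtain K where K: "ereal (norm s) < ereal K" "ereal K < conv_radius w"
      using ereal_dense2[OF s] by blast
    have "summable (\<lambda>k. w k * x ^ k)" if "norm x < K" for x
      using that K(2) by (intro sm_w) (meson ereal_less_eq(3) le_less_trans less_imp_le)
    with K(1) show ?thesis by (intro termdiff_converges[where K=K]) auto
  qed
  define f where "f s = gen_fun w s - s * gen_fun (diffs w) s" for s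
  have cont: "isCont (gen_fun w) s" "isCont (gen_fun (diffs w)) s"
    if s: "ereal (norm s) < conv_radius w" for s
  proof -
    obtain K where K: "ereal (norm s) < ereal K" "ereal K < conv_radius w"
      using ereal_dense2[OF s] by blast
    have sK: "norm s < norm K" using K(1) by auto
    have "0 \<le> K" using K(1) by (auto intro: order_trans[of _ "\<bar>s\<bar>"])
    then have "ereal (norm K) < conv_radius w" using K(2) by simp
    then show "isCont (gen_fun w) s" "isCont (gen_fun (diffs w)) s"
      unfolding gen_fun_def[abs_def] using sK
      by (auto intro!: isCont_powser[where K=K] sm_w sm_diffs)
  qed
  have cont_f: "isCont f s" if "0 \<le> s" "s \<le> t" for s
    unfolding f_def using rad[OF that] by (intro continuous_intros cont) auto
  have "f t > 0"
  proof (rule ccontr)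
    assume "\<not> f t > 0"
    moreover have "f 0 > 0" using w0 by (simp add: f_def gen_fun_0)
    ultimately obtain s where s: "0 \<le> s" "s \<le> t" "f s = 0"
      using IVT2[of f t 0 0] cont_f t by auto
    then have "tau_equation w s"
      using sm_w sm_diffs rad[OF s(1,2)] s by (auto simp: tau_equation_def f_def)
    then show False using none by blast
  qed
  then show ?thesis using sm_diffs[of t] t by (auto simp: f_def)
qed

text \<open>The mean of the tilted distribution is
  \<open>\<tau> \<Phi>'(\<tau>) / \<Phi>(\<tau>)\<close>, which is 1 if \<open>\<tau>\<close> solves
  its equation. Otherwise \<open>\<tau>\<close> is the radius of convergence, so tilting moves the
  radius to 1, and the mean is bounded by approaching \<open>\<tau>\<close> from below.\<close>

lemma tilted_mean:
  assumes nonneg: "\<And>k. w k \<ge> 0" and w0: "w 0 > 0" and tau: "is_tau w \<tau>" and \<tau>: "\<tau> > 0"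
    and sm: "summable (\<lambda>k. w k * \<tau> ^ k)"
  shows "\<exists>\<mu>\<le>1. (\<lambda>k. real k * tilted w \<tau> k) sums \<mu> \<and>
    (\<mu> = 1 \<or> (\<forall>t>1. \<not> summable (\<lambda>k. tilted w \<tau> k * t ^ k)))"
proof -
  define Z where "Z = gen_fun w \<tau>"
  have "w 0 \<le> Z"
    unfolding Z_def gen_fun_def using sum_le_suminf[OF sm, of "{0}"] nonneg \<tau> by simp
  then have Z: "Z > 0" using w0 by simp
  have shift: "t * (diffs w k * t ^ k) = real (Suc k) * (w (Suc k) * t ^ Suc k)" for t k
    by (simp add: diffs_def)
  show ?thesis
  proof (cases "\<exists>t. tau_equation w t")
    case True
    then have eq: "tau_equation w \<tau>" using tau by (simp add: is_tau_def)
    then have "(\<lambda>k. \<tau> * (diffs w k * \<tau> ^ k)) sums Z"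
      unfolding Z_def using sums_mult[OF summable_sums, of "\<lambda>k. diffs w k * \<tau> ^ k" \<tau>]
      by (auto simp: tau_equation_def gen_fun_def)
    then have "(\<lambda>k. real k * (w k * \<tau> ^ k)) sums Z"
      unfolding shift by (subst (asm) sums_Suc_iff) simp
    then have "(\<lambda>k. real k * (w k * \<tau> ^ k) / Z) sums (Z / Z)"
      by (rule sums_divide)
    then have "(\<lambda>k. real k * tilted w \<tau> k) sums 1"
      using Z by (simp add: tilted_def Z_def)
    then show ?thesis by auto
  next
    case False
    then have radius: "conv_radius w = ereal \<tau>" using tau by (simp add: is_tau_def)
    have partial: "(\<Sum>k<N. real k * tilted w \<tau> k) \<le> 1" for N
    proof -
      have le: "(\<Sum>k<N. real k * (w k * t ^ k)) \<le> Z" if t: "0 < t" "t < \<tau>" for t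
      proof -
        note * = mean_le_of_no_tau_equation[where w=w and t=t, OF w0 False t(1)]
        have sm_t: "summable (\<lambda>k. w k * t ^ k)"
          using radius t by (intro summable_in_conv_radius) auto
        have "(\<Sum>k<N. real k * (w k * t ^ k)) \<le> (\<Sum>k<Suc N. real k * (w k * t ^ k))"
          using nonneg t by simp
        also have "\<dots> = (\<Sum>k<N. t * (diffs w k * t ^ k))"
          unfolding shift by (subst sum.lessThan_Suc_shift) simp
        also have "\<dots> \<le> t * gen_fun (diffs w) t"
          unfolding gen_fun_def sum_distrib_left[symmetric] using * t radius nonneg
          by (intro mult_left_mono sum_le_suminf) (auto simp: diffs_def)
        also have "\<dots> \<le> gen_fun w t" using * t radius by simp
        also have "\<dots> \<le> Z"
          unfolding Z_def gen_fun_def using t nonneg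
          by (intro suminf_le sm sm_t mult_left_mono power_mono) auto
        finally show ?thesis .
      qed
      \<comment> \<open>A partial sum is a polynomial in \<open>t\<close>, so the bound extends to
        \<open>\<tau>\<close> before the mean is known to be finite.\<close>
      have "((\<lambda>t. \<Sum>k<N. real k * (w k * t ^ k)) \<longlongrightarrow> (\<Sum>k<N. real k * (w k * \<tau> ^ k)))
          (at_left \<tau>)"
        by (intro tendsto_intros)
      moreover have "\<forall>\<^sub>F t in at_left \<tau>. (\<Sum>k<N. real k * (w k * t ^ k)) \<le> Z"
        unfolding eventually_at_left_field using \<tau> le by (auto intro!: exI[of _ 0])
      ultimately have "(\<Sum>k<N. real k * (w k * \<tau> ^ k)) \<le> Z"
        by (intro tendsto_upperbound) auto
      then show ?thesis
        using Z by (simp add: tilted_def Z_def[symmetric] sum_divide_distrib[symmetric])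
    qed
    have nn: "real k * tilted w \<tau> k \<ge> 0" for k
      using tilted_nonneg[where w=w, OF nonneg _ sm] \<tau> by simp
    have sm_mean: "summable (\<lambda>k. real k * tilted w \<tau> k)"
      by (rule summableI_nonneg_bounded[OF nn partial])
    have "\<not> summable (\<lambda>k. tilted w \<tau> k * t ^ k)" if t: "t > 1" for t
    proof
      assume "summable (\<lambda>k. tilted w \<tau> k * t ^ k)"
      then have "summable (\<lambda>k. Z * (tilted w \<tau> k * t ^ k))" by (rule summable_mult)
      then have "summable (\<lambda>k. w k * (\<tau> * t) ^ k)"
        using Z by (simp add: tilted_def Z_def[symmetric] power_mult_distrib mult_ac)
      then have "ereal (\<tau> * t) \<le> conv_radius w"
        using conv_radius_geI[of w "\<tau> * t"] \<tau> t by simp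
      then show False using radius \<tau> t by simp
    qed
    then show ?thesis
      using suminf_le_const[OF sm_mean partial] summable_sums[OF sm_mean] by blast
  qed
qed

text \<open>If only \<open>w 0\<close> were nonzero, the equation would have no solution and the
  radius would be infinite, hence not the real number \<open>\<tau>\<close>.\<close>

lemma tilted_0_less_1:
  assumes nonneg: "\<And>k. w k \<ge> 0" and w0: "w 0 > 0" and tau: "is_tau w \<tau>" and \<tau>: "\<tau> > 0"
    and sm: "summable (\<lambda>k. w k * \<tau> ^ k)"
  shows "tilted w \<tau> 0 < 1"
proof -
  have "\<exists>k\<ge>1. w k > 0"
  proof (rule ccontr)
    assume "\<not> ?thesis"
    then have w: "w k = 0" if "k \<ge> 1" for k using that nonneg[of k] by (metis less_le)
    have "\<not> tau_equation w t" for t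
    proof
      assume eq: "tau_equation w t"
      have "gen_fun (diffs w) t = 0" by (simp add: gen_fun_def diffs_def w)
      moreover have "gen_fun w t = w 0"
        unfolding gen_fun_def by (subst suminf_finite[of "{0}"]) (auto simp: w)
      ultimately show False using eq w0 by (simp add: tau_equation_def)
    qed
    then have "conv_radius w = ereal \<tau>" using tau by (auto simp: is_tau_def)
    moreover have "summable (\<lambda>k. w k * (\<tau> + 1) ^ k)"
      by (rule summable_finite[of "{0}"]) (auto simp: w)
    ultimately show False using conv_radius_geI[of w "\<tau> + 1"] \<tau> by simp
  qed
  then obtain k where k: "k \<ge> 1" "w k > 0" by blast
  have "sum (\<lambda>k. w k * \<tau> ^ k) {0, k} \<le> gen_fun w \<tau>"
    unfolding gen_fun_def using nonneg \<tau> by (intro sum_le_suminf sm) auto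
  then have "w 0 + w k * \<tau> ^ k \<le> gen_fun w \<tau>" using k by simp
  moreover have "w k * \<tau> ^ k > 0" using k \<tau> by simp
  ultimately show ?thesis using w0 by (simp add: tilted_def)
qed

lemma prop_protected_concentration:
  assumes nonneg: "\<And>k. w k \<ge> 0" and tau: "is_tau w \<tau>" and sm: "summable (\<lambda>k. w k * \<tau> ^ k)"
    and \<epsilon>: "\<epsilon> > 0"
  shows "((\<lambda>n. measure_pmf.prob (simply_generated w n) {T. \<bar>prop_protected T - p_star w \<tau>\<bar> > \<epsilon>})
    \<longlongrightarrow> 0) (inf sequentially (principal (admissible w)))"
proof -
  consider (none) "admissible w = {}" | (zero) "w 0 > 0" "\<tau> = 0" | (pos) "w 0 > 0" "\<tau> > 0"
    using admissible_imp_weight_0_pos[where w=w, OF nonneg] is_tau_nonneg[OF tau] by fastforce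
  then show ?thesis
  proof cases
    \<comment> \<open>The filter is trivial, so every limit holds.\<close>
    case none
    then show ?thesis by simp
  next
    case zero
    \<comment> \<open>At 0 the equation would read \<open>0 = w 0\<close>, so
      \<open>\<tau> = 0\<close> must be the radius of convergence. The tilted distribution is then
      concentrated at 0, and the limit is 0.\<close>
    have "\<not> tau_equation w 0" using zero by (simp add: tau_equation_def gen_fun_0)
    then have "conv_radius w = 0"
      using tau zero by (auto simp: is_tau_def zero_ereal_def split: if_splits)
    moreover have "p_star w \<tau> = 0"
      using zero by (simp add: p_star_def tilted_def gen_fun_0)
    ultimately show ?thesis
      using protected_negligible[where w=w, OF nonneg zero(1) _ \<epsilon>] prop_protected_bounds(1)
      by (simp add: abs_of_nonneg)
  next
    case pos
    let ?p = "tilted w \<tau>"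
    have "w 0 \<le> gen_fun w \<tau>"
      unfolding gen_fun_def using sum_le_suminf[OF sm, of "{0}"] nonneg pos by simp
    then have Z: "gen_fun w \<tau> > 0" using pos by simp
    have nn: "?p k \<ge> 0" for k using tilted_nonneg[where w=w, OF nonneg _ sm] pos by simp
    have sums: "?p sums 1" using tilted_sums[OF sm] Z by simp
    have p0: "0 < ?p 0" "?p 0 < 1"
      using pos Z tilted_0_less_1[where w=w, OF nonneg pos(1) tau pos(2) sm] by (auto simp: tilted_def)
    obtain \<mu> where \<mu>: "\<mu> \<le> 1" "(\<lambda>k. real k * ?p k) sums \<mu>"
      "\<mu> = 1 \<or> (\<forall>t>1. \<not> summable (\<lambda>k. ?p k * t ^ k))"
      using tilted_mean[where w=w, OF nonneg pos(1) tau pos(2) sm] by blast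
    show ?thesis
      using protected_concentration[where p="?p", OF nn sums p0
          partition_fun_growth_prob[where p="?p", OF nn sums p0(1) \<mu>(2,1,3)] \<epsilon>]
      unfolding simply_generated_tilted[OF Z pos(2)] p_star_def .
  qed
qed

theorem theorem1p1:
  fixes w :: "nat \<Rightarrow> real" and \<tau> :: real
  assumes nonneg: "\<And>k. w k \<ge> 0"
    and tau: "is_tau w \<tau>"
    and finite_Phi: "summable (\<lambda>k. w k * \<tau> ^ k)"
  shows "p_star w \<tau> = (gen_fun w (\<tau> - \<tau> * w 0 / gen_fun w \<tau>) - w 0) / gen_fun w \<tau>
    \<and> (\<forall>n \<in> admissible w. pmf (random_node_protected w n) True
          = measure_pmf.expectation (simply_generated w n) prop_protected)
    \<and> ((\<lambda>n. pmf (random_node_protected w n) True) \<longlongrightarrow> p_star w \<tau>)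
          (inf sequentially (principal (admissible w)))
    \<and> (\<forall>\<epsilon>>0. ((\<lambda>n. measure_pmf.prob (simply_generated w n)
                      {T. \<bar>prop_protected T - p_star w \<tau>\<bar> > \<epsilon>}) \<longlongrightarrow> 0)
          (inf sequentially (principal (admissible w))))"
proof -
  note \<tau> = is_tau_nonneg[OF tau]
  note conc = prop_protected_concentration[where w=w, OF nonneg tau finite_Phi]
  have "((\<lambda>n. measure_pmf.expectation (simply_generated w n) prop_protected) \<longlongrightarrow> p_star w \<tau>)
      (inf sequentially (principal (admissible w)))"
    using abs_prop_protected_diff_p_star_le[where w=w, OF nonneg \<tau> finite_Phi] conc
    by (rule expectation_tendsto_of_tendsto_in_prob)
  then show ?thesis
    using p_star_eq[where w=w, OF nonneg \<tau> finite_Phi] conc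
    by (simp add: pmf_random_node_protected)
qed

end
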